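(* Let $\{G_n\}_{n\in\mathbb{N}}$ be a family of expanders, i.e. of $(\mathbb{R},2)$-anders. Then for every infinite-dimensional Banach space $X$ which is sphere equivalent to a uniformly curved Banach space, there are constants $0<c\le C<\infty$, independent of $n$, such that $c\cdot\mathrm{diam}(G_n)\le c_X(G_n)\le C\cdot\mathrm{diam}(G_n)$ for all $n$.
   Context: Graphs $G=(V,E)$ are finite, connected, undirected, possibly with multiple edges and self-loops, with at least two vertices; $E$ is the set of oriented edges. The degree of $v$ is the number of oriented edges $e=(v,w)\in E$ starting at $v$; $\Delta(G)$ is the maximal degree; $G$ carries the path metric, and $\mathrm{diam}(G)$ is its diameter. For a Banach space $X$ and $p\in[1,\infty)$, $$\lambda_1(G;X,p):=\frac12\inf_{f}\frac{\sum_{v\in V}\sum_{e=(v,w)\in E}\|f(w)-f(v)\|^p}{\sum_{v\in V}\|f(v)-m(f)\|^p},\qquad m(f):=\frac1{|V|}\sum_{v\in V}f(v),$$ where $f$ runs over all nonconstant maps $f\colon V\to X$. A sequence $\{G_n\}_n$ is a family of $(X,p)$-anders if $\sup_n\Delta(G_n)<\infty$, $\lim_{n\to\infty}\mathrm{diam}(G_n)=\infty$, and $\inf_n\lambda_1(G_n;X,p)>0$. The distortion of $G$ into $X$ is $c_X(G):=\inf_f\|f\|_{\mathrm{Lip}}\|f^{-1}\|_{\mathrm{Lip}}$, the infimum over all bi-Lipschitz maps $f\colon V\to X$ (with $f^{-1}$ defined on $f(V)$). $S(X)$ denotes the unit sphere of $X$. Two Banach spaces $X,Y$ are sphere equivalent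 if there is a uniform homeomorphism $S(X)\to S(Y)$ (a bijection uniformly continuous in both directions). For a Banach space $X$ and $\epsilon>0$, let $\Lambda_X(\epsilon)$ be the infimum of those $\Lambda\in(0,\infty)$ such that for every $n\in\mathbb{N}$ and every $T=(t_{ij})\in \mathrm{M}_n(\mathbb{R})$ with $\|T\|_{L_2^n(\mathbb{R})\to L_2^n(\mathbb{R})}\le\epsilon$ and $\|\mathrm{abs}(T)\|_{L_2^n(\mathbb{R})\to L_2^n(\mathbb{R})}\le 1$, where $\mathrm{abs}(T)=(|t_{ij}|)$, one has $\|T\otimes I_X\|_{L_2^n(X)\to L_2^n(X)}\le\Lambda$. Here $L_2^n(X)$ is $X^n$ with the norm $(\frac1n\sum_{i=1}^n\|x_i\|^2)^{1/2}$. $X$ is uniformly curved if $\lim_{\epsilon\to+0}\Lambda_X(\epsilon)=0$. *)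

theory Defs
  imports "HOL-Analysis.Analysis" "Graph_Theory.Digraph_Component"
begin

section \<open>Graphs\<close>

text \<open>
  The arcs are the oriented edges. The reversal matches each oriented edge with its opposite, so
  parallel edges have the same multiplicity in both directions. It may fix self-loops (and only
  those): a self-loop may thus contribute either one or two oriented edges. As every arc can be
  traversed backwards, strong connectedness is connectedness of the undirected graph.
\<close>

locale connected_multigraph = fin_digraph G for G :: "('v, 'e) pre_digraph" +
  assumes reversal: "\<exists>rev. \<forall>e\<in>arcs G. rev e \<in> arcs G \<and> rev (rev e) = e \<and>
            tail G (rev e) = head G e \<and> head G (rev e) = tail G e"
    and strongly_conn: "strongly_connected G"
    and two_verts: "2 \<le> card (verts G)"

definition max_degree :: "('v, 'e) pre_digraph \<Rightarrow> nat" where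
  "max_degree G = Max (out_degree G ` verts G)"

definition path_dist :: "('v, 'e) pre_digraph \<Rightarrow> 'v \<Rightarrow> 'v \<Rightarrow> nat" where
  "path_dist G u v = (LEAST k. \<exists>p. pre_digraph.awalk G u p v \<and> length p = k)"

definition diam :: "('v, 'e) pre_digraph \<Rightarrow> nat" where
  "diam G = Max {path_dist G u v | u v. u \<in> verts G \<and> v \<in> verts G}"


section \<open>Spectral gaps and anders\<close>

definition vmean :: "('v, 'e) pre_digraph \<Rightarrow> ('v \<Rightarrow> 'x::banach) \<Rightarrow> 'x" where
  "vmean G f = (1 / real (card (verts G))) *\<^sub>R (\<Sum>v\<in>verts G. f v)"

text \<open>
  Infima and suprema of nonnegative quantities are taken in the extended nonnegative reals, so
  that the infimum over the empty set (when the Banach space is zero) is infinite.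
\<close>

definition lambda1 :: "'x::banach itself \<Rightarrow> real \<Rightarrow> ('v, 'e) pre_digraph \<Rightarrow> ennreal" where
  "lambda1 _ p G = (1/2) * (INF f\<in>{f :: 'v \<Rightarrow> 'x. \<exists>v\<in>verts G. \<exists>w\<in>verts G. f v \<noteq> f w}.
     ennreal ((\<Sum>v\<in>verts G. \<Sum>e\<in>out_arcs G v. norm (f (head G e) - f v) powr p) /
              (\<Sum>v\<in>verts G. norm (f v - vmean G f) powr p)))"

definition anders :: "'x::banach itself \<Rightarrow> real \<Rightarrow> (nat \<Rightarrow> ('v, 'e) pre_digraph) \<Rightarrow> bool" where
  "anders X p G \<longleftrightarrow>
     bdd_above (range (\<lambda>n. max_degree (G n))) \<and>
     filterlim (\<lambda>n. diam (G n)) at_top sequentially \<and>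
     (INF n. lambda1 X p (G n)) > 0"

abbreviation expanders :: "(nat \<Rightarrow> ('v, 'e) pre_digraph) \<Rightarrow> bool" where
  "expanders G \<equiv> anders TYPE(real) 2 G"


section \<open>Distortion\<close>

definition lip_norm ::
    "('a \<Rightarrow> 'a \<Rightarrow> real) \<Rightarrow> ('b \<Rightarrow> 'b \<Rightarrow> real) \<Rightarrow> 'a set \<Rightarrow> ('a \<Rightarrow> 'b) \<Rightarrow> ennreal" where
  "lip_norm dA dB A f =
     (SUP (x, y)\<in>{(x, y). x \<in> A \<and> y \<in> A \<and> x \<noteq> y}. ennreal (dB (f x) (f y) / dA x y))"

definition lip_graph :: "('v, 'e) pre_digraph \<Rightarrow> ('v \<Rightarrow> 'x::banach) \<Rightarrow> ennreal" where
  "lip_graph G f = lip_norm (\<lambda>u v. real (path_dist G u v)) dist (verts G) f"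

definition lip_graph_inv :: "('v, 'e) pre_digraph \<Rightarrow> ('v \<Rightarrow> 'x::banach) \<Rightarrow> ennreal" where
  "lip_graph_inv G f = lip_norm dist (\<lambda>u v. real (path_dist G u v)) (f ` verts G)
     (inv_into (verts G) f)"

definition bi_lipschitz :: "('v, 'e) pre_digraph \<Rightarrow> ('v \<Rightarrow> 'x::banach) \<Rightarrow> bool" where
  "bi_lipschitz G f \<longleftrightarrow> inj_on f (verts G) \<and> lip_graph G f < \<infinity> \<and> lip_graph_inv G f < \<infinity>"

definition distortion :: "'x::banach itself \<Rightarrow> ('v, 'e) pre_digraph \<Rightarrow> ennreal" where
  "distortion _ G =
     (INF f\<in>{f :: 'v \<Rightarrow> 'x. bi_lipschitz G f}. lip_graph G f * lip_graph_inv G f)"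


section \<open>Banach spaces\<close>

text \<open>
  Banach spaces are treated as real Banach spaces; for a complex one, forgetting the complex
  structure changes none of the notions below.
\<close>

definition infinite_dimensional :: "'x::banach itself \<Rightarrow> bool" where
  "infinite_dimensional _ \<longleftrightarrow> \<not> (\<exists>B :: 'x set. finite B \<and> span B = UNIV)"

definition sphere_equivalent :: "'x::banach itself \<Rightarrow> 'y::banach itself \<Rightarrow> bool" where
  "sphere_equivalent _ _ \<longleftrightarrow>
     (\<exists>\<phi> \<psi>. homeomorphism (sphere (0::'x) 1) (sphere (0::'y) 1) \<phi> \<psi> \<and>
       uniformly_continuous_on (sphere 0 1) \<phi> \<and> uniformly_continuous_on (sphere 0 1) \<psi>)"

text \<open>
  An element of \<open>X\<^sup>n\<close> is a function on \<open>nat\<close> of which only the values below \<open>n\<close> matter, and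
  similarly for \<open>n \<times> n\<close> matrices.
\<close>

definition L2_norm :: "nat \<Rightarrow> (nat \<Rightarrow> 'x::banach) \<Rightarrow> real" where
  "L2_norm n x = sqrt ((1 / real n) * (\<Sum>i<n. (norm (x i))\<^sup>2))"

definition tensor_id :: "nat \<Rightarrow> (nat \<Rightarrow> nat \<Rightarrow> real) \<Rightarrow> (nat \<Rightarrow> 'x::banach) \<Rightarrow> nat \<Rightarrow> 'x" where
  "tensor_id n T x = (\<lambda>i. \<Sum>j<n. T i j *\<^sub>R x j)"

text \<open>
  The operator norm of \<open>T \<otimes> I\<^sub>X\<close> on \<open>L\<^sub>2\<^sup>n(X)\<close>, written as in \<^const>\<open>onorm\<close> (with
  \<open>0 / 0 = 0\<close>). The supremum is of a bounded set. For \<open>X = \<real>\<close> this is the operator norm of \<open>T\<close>.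
\<close>

definition tensor_norm :: "'x::banach itself \<Rightarrow> nat \<Rightarrow> (nat \<Rightarrow> nat \<Rightarrow> real) \<Rightarrow> real" where
  "tensor_norm _ n T = (SUP x :: nat \<Rightarrow> 'x. L2_norm n (tensor_id n T x) / L2_norm n x)"

text \<open>The set is nonempty: it contains 1, by the bound on the operator norm of the absolute value.\<close>

definition curvature_modulus :: "'x::banach itself \<Rightarrow> real \<Rightarrow> real" where
  "curvature_modulus X \<epsilon> = Inf {\<Lambda>. 0 < \<Lambda> \<and>
     (\<forall>n>0. \<forall>T :: nat \<Rightarrow> nat \<Rightarrow> real.
        tensor_norm TYPE(real) n T \<le> \<epsilon> \<and> tensor_norm TYPE(real) n (\<lambda>i j. \<bar>T i j\<bar>) \<le> 1
        \<longrightarrow> tensor_norm X n T \<le> \<Lambda>)}"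

definition uniformly_curved :: "'x::banach itself \<Rightarrow> bool" where
  "uniformly_curved X \<longleftrightarrow> (curvature_modulus X \<longlongrightarrow> 0) (at_right 0)"

end

theory Submission
  imports Defs
begin

text \<open>
  The upper bound is soft: an infinite-dimensional Banach space contains arbitrarily many unit vectors
  at mutual distances at least 1/2 (\<open>separated_unit_vectors\<close>), and any bijection of the vertices with
  such vectors has distortion at most four times the diameter (\<open>distortion_le_diam\<close>).

  For the lower bound, the main point is that the expanders satisfy a Poincare inequality, with a
  constant independent of the graph, for maps into the given space, and not just into the reals.
  This comes in two steps.

  If \<open>Y\<close> is uniformly curved, consider the lazy random walk on the graph. The real spectral gap makes a
  high power of it, minus the averaging operator, small on real-valued functions, whereas the absolute
  value of this difference stays bounded. This is exactly the situation in which uniform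
  curvature gives smallness on \<open>Y\<close>-valued functions. So the power of the walk halves mean-zero
  \<open>Y\<close>-valued functions, and this forces a Poincare inequality
  (\<open>uniformly_curved_spectral_gap\<close>, \<open>uniformly_curved_poincare\<close>).

  If \<open>X\<close> is sphere equivalent to \<open>Y\<close>, extend the homeomorphism of the spheres and its inverse radially to
  norm-preserving maps \<open>\<Phi>\<close> and \<open>\<Psi>\<close> between the spaces. They need not be Lipschitz, but for each \<open>\<eta> > 0\<close> there is
  \<open>C\<close> with \<open>norm (\<Phi> a - \<Phi> b) \<le> \<eta> * (norm a + norm b) + C * norm (a - b)\<close>. If a mean-zero map \<open>f\<close> into
  \<open>X\<close> varied little along edges compared with its size, then so would \<open>\<Phi> \<circ> f\<close>; the Poincare inequality for \<open>Y\<close>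
  would make it nearly constant, and applying \<open>\<Psi>\<close> would show that \<open>f\<close> is nearly constant, which contradicts
  its mean being zero (\<open>sphere_equivalent_poincare\<close>).

  Given the Poincare inequality, a map with small Lipschitz constant concentrates at least half of the
  vertices in a small ball of \<open>X\<close>, so that half of the graph has small diameter if the inverse map has
  a small Lipschitz constant too. As degrees are bounded, a ball of small radius can contain half of
  the vertices only if there are few vertices, and as balls in expanders grow exponentially, the
  whole graph then has small diameter (\<open>poincare_bi_lipschitz_diam_le\<close>).
\<close>


section \<open>Dirichlet forms and Poincare inequalities\<close>

definition dirichlet :: "('v, 'e) pre_digraph \<Rightarrow> ('v \<Rightarrow> 'x::banach) \<Rightarrow> real" where
  "dirichlet G f = (\<Sum>v\<in>verts G. \<Sum>e\<in>out_arcs G v. (norm (f (head G e) - f v))\<^sup>2)"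

text \<open>
  The inequality of \<open>lambda1\<close> for the exponent 2, cleared of its denominator: the spectral gap is at
  least \<open>1 / (2 * K)\<close>. In this form constant maps need no exception.
\<close>

definition poincare :: "'x::banach itself \<Rightarrow> real \<Rightarrow> ('v, 'e) pre_digraph \<Rightarrow> bool" where
  "poincare _ K G \<longleftrightarrow>
     (\<forall>f :: 'v \<Rightarrow> 'x. (\<Sum>v\<in>verts G. (norm (f v - vmean G f))\<^sup>2) \<le> K * dirichlet G f)"

lemma norm_sum_sq_le:
  fixes f :: "'a \<Rightarrow> 'x::real_normed_vector"
  assumes "finite A"
  shows "(norm (\<Sum>a\<in>A. f a))\<^sup>2 \<le> real (card A) * (\<Sum>a\<in>A. (norm (f a))\<^sup>2)"
proof -
  have "(norm (\<Sum>a\<in>A. f a))\<^sup>2 \<le> (\<Sum>a\<in>A. 1 * norm (f a))\<^sup>2"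
    by (intro power_mono) (simp_all add: norm_sum)
  also have "\<dots> \<le> (\<Sum>a\<in>A. 1\<^sup>2) * (\<Sum>a\<in>A. (norm (f a))\<^sup>2)"
    by (rule Cauchy_Schwarz_ineq_sum)
  finally show ?thesis by simp
qed

lemma norm_add_sq_le:
  fixes a b :: "'x::real_normed_vector"
  shows "(norm (a + b))\<^sup>2 \<le> 2 * (norm a)\<^sup>2 + 2 * (norm b)\<^sup>2"
proof -
  have "(norm (a + b))\<^sup>2 \<le> (norm a + norm b)\<^sup>2"
    by (intro power_mono norm_triangle_ineq) simp
  also have "\<dots> \<le> 2 * (norm a)\<^sup>2 + 2 * (norm b)\<^sup>2"
    using zero_le_power2[of "norm a - norm b"] by (simp add: power2_sum power2_diff)
  finally show ?thesis .
qed

lemma sum_three_sq_le: "(a + b + c)\<^sup>2 \<le> 3 * a\<^sup>2 + 3 * b\<^sup>2 + 3 * (c::real)\<^sup>2"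
proof -
  have "0 \<le> (a - b)\<^sup>2 + (b - c)\<^sup>2 + (a - c)\<^sup>2" by simp
  then show ?thesis by (simp add: power2_eq_square algebra_simps)
qed

lemma dirichlet_nonneg: "0 \<le> dirichlet G f"
  unfolding dirichlet_def by (intro sum_nonneg) simp

lemma vmean_norm_sq_le:
  assumes "finite (verts G)" "verts G \<noteq> {}"
  shows "real (card (verts G)) * (norm (vmean G f))\<^sup>2 \<le> (\<Sum>v\<in>verts G. (norm (f v))\<^sup>2)"
proof -
  define n where "n = real (card (verts G))"
  have n: "n > 0" using assms by (simp add: n_def card_gt_0_iff)
  have "n * (norm (vmean G f))\<^sup>2 = (1 / n) * (norm (\<Sum>v\<in>verts G. f v))\<^sup>2"
    using n by (simp add: vmean_def n_def[symmetric] power_divide power2_eq_square)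
  also have "\<dots> \<le> (1 / n) * (n * (\<Sum>v\<in>verts G. (norm (f v))\<^sup>2))"
    unfolding n_def using norm_sum_sq_le[OF assms(1)] by (intro mult_left_mono) auto
  also have "\<dots> = (\<Sum>v\<in>verts G. (norm (f v))\<^sup>2)" using n by simp
  finally show ?thesis by (simp add: n_def)
qed

lemma vmean_diff_const:
  assumes "finite (verts G)" "verts G \<noteq> {}"
  shows "vmean G (\<lambda>v. f v - c) = vmean G f - c"
proof -
  have "real (card (verts G)) \<noteq> 0" using assms by simp
  moreover have "(\<Sum>v\<in>verts G. c) = real (card (verts G)) *\<^sub>R c"
    by (rule sum_constant_scaleR)
  ultimately show ?thesis
    unfolding vmean_def sum_subtractf by (simp add: scaleR_diff_right)
qed

text \<open>
  In a Hilbert space the mean minimizes the mean square deviation; in a Banach space it does so up to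
  the factor 4, since moving the centre from \<open>c\<close> to the mean of \<open>f\<close> is a step whose square is at most
  the mean square deviation from \<open>c\<close>. The nonlinear transfer between two spaces does not respect means, so this is what allows replacing the mean by
  any other centre.
\<close>

lemma vmean_is_almost_optimal:
  assumes "finite (verts G)" "verts G \<noteq> {}"
  shows "(\<Sum>v\<in>verts G. (norm (f v - vmean G f))\<^sup>2) \<le> 4 * (\<Sum>v\<in>verts G. (norm (f v - c))\<^sup>2)"
proof -
  have "(\<Sum>v\<in>verts G. (norm (f v - vmean G f))\<^sup>2)
     \<le> (\<Sum>v\<in>verts G. 2 * (norm (f v - c))\<^sup>2 + 2 * (norm (vmean G (\<lambda>v. f v - c)))\<^sup>2)"
  proof (intro sum_mono)
    fix v
    show "(norm (f v - vmean G f))\<^sup>2 \<le> 2 * (norm (f v - c))\<^sup>2 + 2 * (norm (vmean G (\<lambda>v. f v - c)))\<^sup>2"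
      using norm_add_sq_le[of "f v - c" "- vmean G (\<lambda>v. f v - c)"]
      by (simp add: vmean_diff_const[OF assms] norm_minus_commute)
  qed
  also have "\<dots> = 2 * (\<Sum>v\<in>verts G. (norm (f v - c))\<^sup>2)
      + 2 * (real (card (verts G)) * (norm (vmean G (\<lambda>v. f v - c)))\<^sup>2)"
    by (simp add: sum.distrib sum_distrib_left)
  also have "\<dots> \<le> 4 * (\<Sum>v\<in>verts G. (norm (f v - c))\<^sup>2)"
    using vmean_norm_sq_le[OF assms, of "\<lambda>v. f v - c"] by simp
  finally show ?thesis .
qed

context connected_multigraph
begin

lemma card_verts_pos: "0 < card (verts G)"
  using two_verts by linarith

lemma verts_nonempty: "verts G \<noteq> {}"
  using card_verts_pos by force

lemma out_degree_le_max_degree: "v \<in> verts G \<Longrightarrow> out_degree G v \<le> max_degree G"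
  unfolding max_degree_def by (intro Max_ge) auto

lemma sum_out_arcs:
  "(\<Sum>v\<in>verts G. \<Sum>e\<in>out_arcs G v. F v (head G e)) = (\<Sum>e\<in>arcs G. F (tail G e) (head G e))"
proof -
  have "(\<Sum>v\<in>verts G. \<Sum>e\<in>out_arcs G v. F v (head G e)) =
        (\<Sum>v\<in>verts G. \<Sum>e | e \<in> arcs G \<and> tail G e = v. F (tail G e) (head G e))"
    by (intro sum.cong) (auto simp: out_arcs_def)
  also have "\<dots> = (\<Sum>e\<in>arcs G. F (tail G e) (head G e))"
    by (intro sum.group) (auto simp: tail_in_verts)
  finally show ?thesis .
qed

lemma sum_arcs_reverse:
  "(\<Sum>e\<in>arcs G. F (tail G e) (head G e)) = (\<Sum>e\<in>arcs G. F (head G e) (tail G e))"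
proof -
  obtain rev where rev: "\<forall>e\<in>arcs G. rev e \<in> arcs G \<and> rev (rev e) = e \<and>
            tail G (rev e) = head G e \<and> head G (rev e) = tail G e"
    using reversal by blast
  show ?thesis
    by (rule sum.reindex_bij_witness[where i = rev and j = rev]) (use rev in auto)
qed

lemma sum_out_arcs_tail_le:
  assumes "\<And>v. v \<in> verts G \<Longrightarrow> out_degree G v \<le> D" "\<And>v. 0 \<le> (h v :: real)"
  shows "(\<Sum>v\<in>verts G. \<Sum>e\<in>out_arcs G v. h v) \<le> real D * (\<Sum>v\<in>verts G. h v)"
proof -
  have "(\<Sum>v\<in>verts G. \<Sum>e\<in>out_arcs G v. h v) = (\<Sum>v\<in>verts G. real (out_degree G v) * h v)"
    by (simp add: out_degree_def)
  also have "\<dots> \<le> (\<Sum>v\<in>verts G. real D * h v)"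
    using assms by (intro sum_mono mult_right_mono) auto
  finally show ?thesis by (simp add: sum_distrib_left)
qed

text \<open>
  Every vertex is the head of as many oriented edges as it is the tail of, by the reversal.
\<close>

lemma sum_out_arcs_head_le:
  assumes "\<And>v. v \<in> verts G \<Longrightarrow> out_degree G v \<le> D" "\<And>v. 0 \<le> (h v :: real)"
  shows "(\<Sum>v\<in>verts G. \<Sum>e\<in>out_arcs G v. h (head G e)) \<le> real D * (\<Sum>v\<in>verts G. h v)"
proof -
  have "(\<Sum>v\<in>verts G. \<Sum>e\<in>out_arcs G v. h (head G e)) = (\<Sum>v\<in>verts G. \<Sum>e\<in>out_arcs G v. h v)"
    using sum_out_arcs[of "\<lambda>v w. h w"] sum_out_arcs[of "\<lambda>v w. h v"]
      sum_arcs_reverse[of "\<lambda>v w. h w"] by simp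
  then show ?thesis using sum_out_arcs_tail_le[OF assms] by simp
qed

end

lemma expanders_poincare:
  fixes G :: "nat \<Rightarrow> ('v, 'e) pre_digraph"
  assumes G: "\<And>n. connected_multigraph (G n)" and "expanders G"
  obtains K where "0 < K" "\<And>n. poincare TYPE(real) K (G n)"
proof -
  have "(INF n. lambda1 TYPE(real) 2 (G n)) > 0"
    using assms(2) by (simp add: anders_def)
  then obtain l' where l': "0 < l'" "l' < (INF n. lambda1 TYPE(real) 2 (G n))"
    using dense by blast
  obtain l where l: "l' = ennreal l" "0 \<le> l"
    using l' by (cases l') auto
  have lpos: "l > 0" using l l' by simp
  have "poincare TYPE(real) (1 / (2 * l)) (G n)" for n
    unfolding poincare_def
  proof
    fix f :: "'v \<Rightarrow> real"
    interpret connected_multigraph "G n" by (rule G)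
    let ?S = "\<Sum>v\<in>verts (G n). (norm (f v - vmean (G n) f))\<^sup>2"
    show "?S \<le> 1 / (2 * l) * dirichlet (G n) f"
    proof (cases "?S = 0")
      case True
      then show ?thesis using lpos dirichlet_nonneg[of "G n" f] by simp
    next
      case False
      have S: "0 \<le> ?S" by (intro sum_nonneg) simp
      have nonconst: "\<exists>v\<in>verts (G n). \<exists>w\<in>verts (G n). f v \<noteq> f w"
      proof (rule ccontr)
        assume c: "\<not> ?thesis"
        obtain u where u: "u \<in> verts (G n)" using verts_nonempty by blast
        have fu: "f v = f u" if "v \<in> verts (G n)" for v using c u that by blast
        have "vmean (G n) f = f u"
          unfolding vmean_def using verts_nonempty fu by (simp cong: sum.cong)
        then have "?S = 0" using fu by simp
        then show False using False by simp
      qed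
      have p2: "norm x powr 2 = (norm x)\<^sup>2" for x :: real
        by (simp add: powr_numeral)
      have "ennreal l \<le> lambda1 TYPE(real) 2 (G n)"
        using l l' by (meson INF_lower UNIV_I less_imp_le order_trans)
      also have "\<dots> \<le> (1 / 2) * ennreal (dirichlet (G n) f / ?S)"
        unfolding lambda1_def
        by (intro mult_left_mono INF_lower2[where i = f]) (use nonconst in \<open>auto simp: dirichlet_def p2\<close>)
      also have "(1 / 2 :: ennreal) = ennreal (1 / 2)"
        by (metis divide_ennreal ennreal_1 ennreal_numeral zero_le_numeral zero_le_one zero_less_numeral)
      finally have "ennreal l \<le> ennreal ((1 / 2) * (dirichlet (G n) f / ?S))"
        by (subst ennreal_mult') simp_all
      then have "l \<le> (1 / 2) * (dirichlet (G n) f / ?S)"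
        using dirichlet_nonneg[of "G n" f] S by (subst (asm) ennreal_le_iff) auto
      then show ?thesis
        using S False lpos by (simp add: field_simps)
    qed
  qed
  then show ?thesis using lpos that[of "1 / (2 * l)"] by simp
qed


section \<open>Matrices acting on vectors with values in a Banach space\<close>

lemma L2_norm_eq: "L2_norm n x = sqrt (1 / real n) * L2_set (\<lambda>i. norm (x i)) {..<n}"
  unfolding L2_norm_def L2_set_def by (rule real_sqrt_mult)

lemma L2_norm_nonneg: "0 \<le> L2_norm n x"
  by (simp add: L2_norm_eq)

lemma L2_norm_mono:
  assumes "\<And>i. i < n \<Longrightarrow> norm (x i) \<le> norm (y i)"
  shows "L2_norm n x \<le> L2_norm n y"
  unfolding L2_norm_eq using assms by (intro mult_left_mono L2_set_mono) auto

lemma L2_norm_cong: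
  assumes "\<And>i. i < n \<Longrightarrow> x i = y i"
  shows "L2_norm n x = L2_norm n y"
  using assms by (intro antisym L2_norm_mono) auto

lemma L2_norm_triangle: "L2_norm n (\<lambda>i. x i + y i) \<le> L2_norm n x + L2_norm n y"
proof -
  have "L2_set (\<lambda>i. norm (x i + y i)) {..<n} \<le> L2_set (\<lambda>i. norm (x i) + norm (y i)) {..<n}"
    by (intro L2_set_mono norm_triangle_ineq) auto
  also have "\<dots> \<le> L2_set (\<lambda>i. norm (x i)) {..<n} + L2_set (\<lambda>i. norm (y i)) {..<n}"
    by (rule L2_set_triangle_ineq)
  finally show ?thesis
    unfolding L2_norm_eq distrib_left[symmetric] by (intro mult_left_mono) auto
qed

lemma L2_norm_scaleR: "L2_norm n (\<lambda>i. c *\<^sub>R x i) = \<bar>c\<bar> * L2_norm n x"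
  unfolding L2_norm_def
  by (simp add: power_mult_distrib sum_distrib_left[symmetric] real_sqrt_mult mult.assoc[symmetric])
     (simp add: real_sqrt_mult real_sqrt_divide)

lemma L2_norm_norm: "L2_norm n (\<lambda>i. norm (x i)) = L2_norm n x"
  by (simp add: L2_norm_def)

lemma L2_norm_sq: "0 < n \<Longrightarrow> real n * (L2_norm n x)\<^sup>2 = (\<Sum>i<n. (norm (x i))\<^sup>2)"
  unfolding L2_norm_def by (subst real_sqrt_pow2) (auto intro!: sum_nonneg divide_nonneg_nonneg)

lemma L2_norm_le_iff:
  assumes "0 < n" "0 \<le> c"
  shows "L2_norm n x \<le> c * L2_norm n y \<longleftrightarrow> (\<Sum>i<n. (norm (x i))\<^sup>2) \<le> c\<^sup>2 * (\<Sum>i<n. (norm (y i))\<^sup>2)"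
proof -
  have "L2_norm n x \<le> c * L2_norm n y \<longleftrightarrow> (L2_norm n x)\<^sup>2 \<le> (c * L2_norm n y)\<^sup>2"
    using assms by (intro power2_le_iff_abs_le[symmetric, THEN trans[rotated]] ) (auto simp: L2_norm_nonneg)
  also have "\<dots> \<longleftrightarrow> real n * (L2_norm n x)\<^sup>2 \<le> c\<^sup>2 * (real n * (L2_norm n y)\<^sup>2)"
    using assms by (simp add: power_mult_distrib mult.left_commute)
  finally show ?thesis using assms by (simp add: L2_norm_sq)
qed

lemma L2_norm_le_iff_sum_le:
  "0 < n \<Longrightarrow> L2_norm n x \<le> L2_norm n y \<longleftrightarrow> (\<Sum>i<n. (norm (x i))\<^sup>2) \<le> (\<Sum>i<n. (norm (y i))\<^sup>2)"
  using L2_norm_le_iff[of n 1 x y] by simp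

lemma L2_norm_mean_le:
  assumes "0 < n"
  shows "L2_norm n (\<lambda>_. (1 / real n) *\<^sub>R (\<Sum>j<n. x j)) \<le> L2_norm n x"
proof -
  have "(norm (\<Sum>j<n. x j))\<^sup>2 \<le> real n * (\<Sum>j<n. (norm (x j))\<^sup>2)"
    using norm_sum_sq_le[of "{..<n}" x] by simp
  then have "(\<Sum>i<n. (norm ((1 / real n) *\<^sub>R (\<Sum>j<n. x j)))\<^sup>2) \<le> (\<Sum>j<n. (norm (x j))\<^sup>2)"
    using assms by (simp add: power_divide power2_eq_square field_simps)
  then show ?thesis by (subst L2_norm_le_iff_sum_le[OF assms]) simp
qed

lemma tensor_norm_le:
  fixes X :: "'x::banach itself"
  assumes "0 \<le> c" "\<And>x :: nat \<Rightarrow> 'x. L2_norm n (tensor_id n T x) \<le> c * L2_norm n x"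
  shows "tensor_norm X n T \<le> c"
  unfolding tensor_norm_def
proof (rule cSUP_least)
  fix x :: "nat \<Rightarrow> 'x"
  show "L2_norm n (tensor_id n T x) / L2_norm n x \<le> c"
    using assms L2_norm_nonneg[of n x] by (cases "L2_norm n x = 0") (auto simp: divide_le_eq)
qed simp

text \<open>
  A crude bound, whose only purpose is that the supremum in \<open>tensor_norm\<close> is finite, so that it does
  bound each of its terms.
\<close>

lemma L2_norm_tensor_id_le_entries:
  assumes "0 < n"
  shows "L2_norm n (tensor_id n T x) \<le> sqrt (\<Sum>i<n. \<Sum>j<n. (T i j)\<^sup>2) * L2_norm n x"
proof (subst L2_norm_le_iff)
  have "(norm (tensor_id n T x i))\<^sup>2 \<le> (\<Sum>j<n. (T i j)\<^sup>2) * (\<Sum>j<n. (norm (x j))\<^sup>2)" for i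
  proof -
    have "(norm (tensor_id n T x i))\<^sup>2 \<le> (\<Sum>j<n. \<bar>T i j\<bar> * norm (x j))\<^sup>2"
      unfolding tensor_id_def by (intro power_mono order_trans[OF norm_sum]) auto
    also have "\<dots> \<le> (\<Sum>j<n. \<bar>T i j\<bar>\<^sup>2) * (\<Sum>j<n. (norm (x j))\<^sup>2)"
      by (rule Cauchy_Schwarz_ineq_sum)
    finally show ?thesis by simp
  qed
  then have "(\<Sum>i<n. (norm (tensor_id n T x i))\<^sup>2) \<le> (\<Sum>i<n. (\<Sum>j<n. (T i j)\<^sup>2) * (\<Sum>j<n. (norm (x j))\<^sup>2))"
    by (intro sum_mono)
  also have "\<dots> = (sqrt (\<Sum>i<n. \<Sum>j<n. (T i j)\<^sup>2))\<^sup>2 * (\<Sum>j<n. (norm (x j))\<^sup>2)"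
    by (subst real_sqrt_pow2) (auto intro!: sum_nonneg simp: sum_distrib_right)
  finally show "(\<Sum>i<n. (norm (tensor_id n T x i))\<^sup>2)
    \<le> (sqrt (\<Sum>i<n. \<Sum>j<n. (T i j)\<^sup>2))\<^sup>2 * (\<Sum>j<n. (norm (x j))\<^sup>2)" .
qed (use assms in \<open>auto intro!: sum_nonneg\<close>)

lemma L2_norm_tensor_id_le:
  fixes x :: "nat \<Rightarrow> 'x::banach"
  assumes "0 < n"
  shows "L2_norm n (tensor_id n T x) \<le> tensor_norm TYPE('x) n T * L2_norm n x"
proof (cases "L2_norm n x = 0")
  case True
  then show ?thesis using L2_norm_tensor_id_le_entries[OF assms, of T x] by simp
next
  case False
  then have pos: "0 < L2_norm n x" using L2_norm_nonneg[of n x] by linarith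
  have "bdd_above (range (\<lambda>x :: nat \<Rightarrow> 'x. L2_norm n (tensor_id n T x) / L2_norm n x))"
  proof (rule bdd_aboveI2)
    fix x :: "nat \<Rightarrow> 'x"
    show "L2_norm n (tensor_id n T x) / L2_norm n x \<le> sqrt (\<Sum>i<n. \<Sum>j<n. (T i j)\<^sup>2)"
      using L2_norm_tensor_id_le_entries[OF assms, of T x] L2_norm_nonneg[of n x]
      by (cases "L2_norm n x = 0") (auto simp: divide_le_eq intro!: sum_nonneg)
  qed
  then have "L2_norm n (tensor_id n T x) / L2_norm n x \<le> tensor_norm TYPE('x) n T"
    unfolding tensor_norm_def by (rule cSUP_upper[OF UNIV_I])
  then show ?thesis using pos by (simp add: divide_le_eq)
qed

text \<open>
  Domination by the absolute value of the matrix holds in every Banach space. It shows that 1 belongs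
  to the set of which \<open>curvature_modulus\<close> is the infimum, so that smallness of the modulus yields an
  actual bound. The maximum with 0 makes the bound visibly nonnegative, as \<open>tensor_norm_le\<close> asks.
\<close>

lemma tensor_norm_le_abs:
  fixes X :: "'x::banach itself"
  assumes "0 < n"
  shows "tensor_norm X n T \<le> max 0 (tensor_norm TYPE(real) n (\<lambda>i j. \<bar>T i j\<bar>))"
proof (rule tensor_norm_le)
  fix x :: "nat \<Rightarrow> 'x"
  have "L2_norm n (tensor_id n T x) \<le> L2_norm n (tensor_id n (\<lambda>i j. \<bar>T i j\<bar>) (\<lambda>i. norm (x i)))"
  proof (rule L2_norm_mono)
    fix i
    have "norm (tensor_id n T x i) \<le> (\<Sum>j<n. \<bar>T i j\<bar> * norm (x j))"
      unfolding tensor_id_def by (intro order_trans[OF norm_sum]) simp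
    then show "norm (tensor_id n T x i) \<le> norm (tensor_id n (\<lambda>i j. \<bar>T i j\<bar>) (\<lambda>i. norm (x i)) i)"
      by (simp add: tensor_id_def)
  qed
  also have "\<dots> \<le> tensor_norm TYPE(real) n (\<lambda>i j. \<bar>T i j\<bar>) * L2_norm n x"
    using L2_norm_tensor_id_le[OF assms] by (metis L2_norm_norm)
  also have "\<dots> \<le> max 0 (tensor_norm TYPE(real) n (\<lambda>i j. \<bar>T i j\<bar>)) * L2_norm n x"
    by (intro mult_right_mono L2_norm_nonneg) simp
  finally show "L2_norm n (tensor_id n T x)
    \<le> max 0 (tensor_norm TYPE(real) n (\<lambda>i j. \<bar>T i j\<bar>)) * L2_norm n x" .
qed simp

lemma uniformly_curvedD:
  assumes "uniformly_curved TYPE('y::banach)" "0 < \<delta>"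
  obtains \<epsilon> where "0 < \<epsilon>"
    "\<And>n T. 0 < n \<Longrightarrow> tensor_norm TYPE(real) n T \<le> \<epsilon> \<Longrightarrow> tensor_norm TYPE(real) n (\<lambda>i j. \<bar>T i j\<bar>) \<le> 1
       \<Longrightarrow> tensor_norm TYPE('y) n T \<le> \<delta>"
proof -
  have "\<forall>\<^sub>F \<epsilon> in at_right 0. curvature_modulus TYPE('y) \<epsilon> < \<delta>"
    using assms unfolding uniformly_curved_def by (intro order_tendstoD)
  then obtain b where b: "0 < b" "\<And>\<epsilon>. 0 < \<epsilon> \<Longrightarrow> \<epsilon> < b \<Longrightarrow> curvature_modulus TYPE('y) \<epsilon> < \<delta>"
    unfolding eventually_at_right_field by auto
  define \<epsilon> where "\<epsilon> = b / 2"
  let ?S = "{\<Lambda>. 0 < \<Lambda> \<and>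
     (\<forall>n>0. \<forall>T :: nat \<Rightarrow> nat \<Rightarrow> real.
        tensor_norm TYPE(real) n T \<le> \<epsilon> \<and> tensor_norm TYPE(real) n (\<lambda>i j. \<bar>T i j\<bar>) \<le> 1
        \<longrightarrow> tensor_norm TYPE('y) n T \<le> \<Lambda>)}"
  have "tensor_norm TYPE('y) n T \<le> 1"
    if "0 < n" "tensor_norm TYPE(real) n (\<lambda>i j. \<bar>T i j\<bar>) \<le> 1" for n T
  proof -
    have "tensor_norm TYPE('y) n T \<le> max 0 (tensor_norm TYPE(real) n (\<lambda>i j. \<bar>T i j\<bar>))"
      by (rule tensor_norm_le_abs[OF that(1)])
    also have "\<dots> \<le> 1" using that(2) by simp
    finally show ?thesis .
  qed
  then have "1 \<in> ?S" by simp
  then have "?S \<noteq> {}" by blast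
  moreover have "Inf ?S < \<delta>"
    using b(2)[of \<epsilon>] b(1) by (simp add: curvature_modulus_def \<epsilon>_def)
  ultimately obtain \<Lambda> where \<Lambda>: "\<Lambda> \<in> ?S" "\<Lambda> < \<delta>"
    by (meson cInf_lessD)
  show ?thesis
  proof (rule that)
    show "0 < \<epsilon>" using b(1) by (simp add: \<epsilon>_def)
    fix n T
    assume "0 < n" "tensor_norm TYPE(real) n T \<le> \<epsilon>" "tensor_norm TYPE(real) n (\<lambda>i j. \<bar>T i j\<bar>) \<le> 1"
    then have "tensor_norm TYPE('y) n T \<le> \<Lambda>" using \<Lambda>(1) by simp
    then show "tensor_norm TYPE('y) n T \<le> \<delta>" using \<Lambda>(2) by simp
  qed
qed


section \<open>Doubly stochastic matrices and uniform curvature\<close>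

fun mat_pow :: "nat \<Rightarrow> (nat \<Rightarrow> nat \<Rightarrow> real) \<Rightarrow> nat \<Rightarrow> nat \<Rightarrow> nat \<Rightarrow> real" where
  "mat_pow n A 0 i j = (if i = j then 1 else 0)"
| "mat_pow n A (Suc k) i j = (\<Sum>l<n. A i l * mat_pow n A k l j)"

lemma tensor_id_mat_pow:
  assumes "i < n"
  shows "tensor_id n (mat_pow n A k) x i = (tensor_id n A ^^ k) x i"
  using assms
proof (induction k arbitrary: i)
  case 0
  have "(\<Sum>j<n. (if i = j then 1 else 0) *\<^sub>R x j) = (\<Sum>j<n. if i = j then x j else 0)"
    by (intro sum.cong) auto
  then show ?case using 0 by (simp add: tensor_id_def)
next
  case (Suc k)
  have "tensor_id n (mat_pow n A (Suc k)) x i = (\<Sum>j<n. \<Sum>l<n. (A i l * mat_pow n A k l j) *\<^sub>R x j)"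
    by (simp add: tensor_id_def scaleR_sum_left)
  also have "\<dots> = (\<Sum>l<n. A i l *\<^sub>R tensor_id n (mat_pow n A k) x l)"
    by (subst sum.swap) (simp add: tensor_id_def scaleR_sum_right)
  also have "\<dots> = (\<Sum>l<n. A i l *\<^sub>R (tensor_id n A ^^ k) x l)"
    by (intro sum.cong) (simp_all add: Suc.IH)
  also have "\<dots> = (tensor_id n A ^^ Suc k) x i"
    by (simp add: tensor_id_def[of n A "(tensor_id n A ^^ k) x"])
  finally show ?case .
qed

definition doubly_stochastic :: "nat \<Rightarrow> (nat \<Rightarrow> nat \<Rightarrow> real) \<Rightarrow> bool" where
  "doubly_stochastic n A \<longleftrightarrow> (\<forall>i<n. \<forall>j<n. 0 \<le> A i j) \<and>
     (\<forall>i<n. (\<Sum>j<n. A i j) = 1) \<and> (\<forall>j<n. (\<Sum>i<n. A i j) = 1)"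

lemma doubly_stochastic_mat_pow:
  assumes "doubly_stochastic n A"
  shows "doubly_stochastic n (mat_pow n A k)"
proof (induction k)
  case 0
  show ?case by (auto simp: doubly_stochastic_def)
next
  case (Suc k)
  have "(\<Sum>j<n. mat_pow n A (Suc k) i j) = 1" if "i < n" for i
  proof -
    have "(\<Sum>j<n. mat_pow n A (Suc k) i j) = (\<Sum>l<n. A i l * (\<Sum>j<n. mat_pow n A k l j))"
      by (simp add: sum_distrib_left) (rule sum.swap)
    also have "\<dots> = (\<Sum>l<n. A i l)"
      using Suc by (auto simp: doubly_stochastic_def intro!: sum.cong)
    finally show ?thesis using assms that by (simp add: doubly_stochastic_def)
  qed
  moreover have "(\<Sum>i<n. mat_pow n A (Suc k) i j) = 1" if "j < n" for j
  proof -
    have "(\<Sum>i<n. mat_pow n A (Suc k) i j) = (\<Sum>l<n. (\<Sum>i<n. A i l) * mat_pow n A k l j)"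
      by (simp add: sum_distrib_right) (rule sum.swap)
    also have "\<dots> = (\<Sum>l<n. mat_pow n A k l j)"
      using assms by (auto simp: doubly_stochastic_def intro!: sum.cong)
    finally show ?thesis using Suc that by (simp add: doubly_stochastic_def)
  qed
  moreover have "0 \<le> mat_pow n A (Suc k) i j" if "i < n" "j < n" for i j
    using assms Suc that by (auto simp: doubly_stochastic_def intro!: sum_nonneg mult_nonneg_nonneg)
  ultimately show ?case by (simp add: doubly_stochastic_def)
qed

text \<open>
  By convexity of the square, row sums 1 give the pointwise bound by a weighted mean of squares, and
  column sums 1 make these means add up to the total.
\<close>

lemma doubly_stochastic_contraction:
  assumes A: "doubly_stochastic n A" and n: "0 < n"
  shows "L2_norm n (tensor_id n A x) \<le> L2_norm n x"
proof -
  have row: "(norm (tensor_id n A x i))\<^sup>2 \<le> (\<Sum>j<n. A i j * (norm (x j))\<^sup>2)" if i: "i < n" for i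
  proof -
    have nn: "\<And>j. j < n \<Longrightarrow> 0 \<le> A i j" and one: "(\<Sum>j<n. A i j) = 1"
      using A i by (auto simp: doubly_stochastic_def)
    have "norm (tensor_id n A x i) \<le> (\<Sum>j<n. A i j * norm (x j))"
      unfolding tensor_id_def using nn by (intro order_trans[OF norm_sum] sum_mono) auto
    also have "\<dots> = (\<Sum>j<n. sqrt (A i j) * (sqrt (A i j) * norm (x j)))"
      using nn by (intro sum.cong) (auto simp: mult.assoc[symmetric])
    finally have "(norm (tensor_id n A x i))\<^sup>2 \<le> (\<Sum>j<n. sqrt (A i j) * (sqrt (A i j) * norm (x j)))\<^sup>2"
      by (intro power_mono) auto
    also have "\<dots> \<le> (\<Sum>j<n. (sqrt (A i j))\<^sup>2) * (\<Sum>j<n. (sqrt (A i j) * norm (x j))\<^sup>2)"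
      by (rule Cauchy_Schwarz_ineq_sum)
    also have "(\<Sum>j<n. (sqrt (A i j))\<^sup>2) = 1"
      using nn one by simp
    also have "(\<Sum>j<n. (sqrt (A i j) * norm (x j))\<^sup>2) = (\<Sum>j<n. A i j * (norm (x j))\<^sup>2)"
      using nn by (intro sum.cong) (auto simp: power_mult_distrib)
    finally show ?thesis by simp
  qed
  have "(\<Sum>i<n. (norm (tensor_id n A x i))\<^sup>2) \<le> (\<Sum>i<n. \<Sum>j<n. A i j * (norm (x j))\<^sup>2)"
    using row by (intro sum_mono) auto
  also have "\<dots> = (\<Sum>j<n. (\<Sum>i<n. A i j) * (norm (x j))\<^sup>2)"
    by (subst sum.swap) (simp add: sum_distrib_right)
  also have "\<dots> = (\<Sum>j<n. (norm (x j))\<^sup>2)"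
    using A by (auto simp: doubly_stochastic_def intro!: sum.cong)
  finally show ?thesis by (subst L2_norm_le_iff_sum_le[OF n])
qed

lemma doubly_stochastic_sum:
  assumes A: "doubly_stochastic n A"
  shows "(\<Sum>i<n. tensor_id n A x i) = (\<Sum>i<n. x i)"
proof -
  have "(\<Sum>i<n. tensor_id n A x i) = (\<Sum>j<n. (\<Sum>i<n. A i j) *\<^sub>R x j)"
    unfolding tensor_id_def by (subst sum.swap) (simp add: scaleR_sum_left)
  also have "\<dots> = (\<Sum>i<n. x i)"
    using A by (auto simp: doubly_stochastic_def intro!: sum.cong)
  finally show ?thesis .
qed

lemma tensor_id_diff: "tensor_id n A (\<lambda>i. x i - y i) = (\<lambda>i. tensor_id n A x i - tensor_id n A y i)"
  by (simp add: tensor_id_def scaleR_diff_right sum_subtractf)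

text \<open>
  Telescoping: since powers of the matrix are contractions, \<open>k\<close> steps move a vector by at most \<open>k\<close>
  times the displacement of one step.
\<close>

lemma L2_norm_iterate_diff:
  assumes A: "doubly_stochastic n A" and n: "0 < n"
  shows "L2_norm n (\<lambda>i. x i - (tensor_id n A ^^ k) x i) \<le> real k * L2_norm n (\<lambda>i. x i - tensor_id n A x i)"
proof (induction k)
  case 0
  show ?case by (simp add: L2_norm_def)
next
  case (Suc k)
  have "L2_norm n (\<lambda>i. x i - (tensor_id n A ^^ Suc k) x i)
      = L2_norm n (\<lambda>i. (x i - tensor_id n A x i) + tensor_id n A (\<lambda>i. x i - (tensor_id n A ^^ k) x i) i)"
    by (simp add: tensor_id_diff)
  also have "\<dots> \<le> L2_norm n (\<lambda>i. x i - tensor_id n A x i)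
      + L2_norm n (tensor_id n A (\<lambda>i. x i - (tensor_id n A ^^ k) x i))"
    by (rule L2_norm_triangle)
  also have "\<dots> \<le> L2_norm n (\<lambda>i. x i - tensor_id n A x i) + real k * L2_norm n (\<lambda>i. x i - tensor_id n A x i)"
    using doubly_stochastic_contraction[OF A n] Suc by (intro add_left_mono) (rule order_trans)
  finally show ?case by (simp add: algebra_simps)
qed

lemma mean_zero_iterate:
  fixes x :: "nat \<Rightarrow> real"
  assumes A: "doubly_stochastic n A" and n: "0 < n" and r: "0 \<le> r"
    and gap: "\<And>x :: nat \<Rightarrow> real. (\<Sum>i<n. x i) = 0 \<Longrightarrow> L2_norm n (tensor_id n A x) \<le> r * L2_norm n x"
    and x: "(\<Sum>i<n. x i) = 0"
  shows "L2_norm n ((tensor_id n A ^^ k) x) \<le> r ^ k * L2_norm n x \<and> (\<Sum>i<n. (tensor_id n A ^^ k) x i) = 0"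
proof (induction k)
  case (Suc k)
  then have "L2_norm n ((tensor_id n A ^^ Suc k) x) \<le> r * L2_norm n ((tensor_id n A ^^ k) x)"
    using gap by simp
  also have "\<dots> \<le> r * (r ^ k * L2_norm n x)"
    using Suc r by (intro mult_left_mono) auto
  finally show ?case
    using Suc by (simp add: doubly_stochastic_sum[OF A] mult.assoc)
qed (use x in simp)

lemma L2_norm_centre_le:
  fixes x :: "nat \<Rightarrow> real"
  assumes "0 < n"
  shows "L2_norm n (\<lambda>i. x i - (\<Sum>j<n. x j) / real n) \<le> L2_norm n x"
proof -
  define m where "m = (\<Sum>j<n. x j) / real n"
  have "(\<Sum>i<n. (x i - m)\<^sup>2) = (\<Sum>i<n. (x i)\<^sup>2) - 2 * m * (\<Sum>i<n. x i) + real n * m\<^sup>2"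
    by (simp add: power2_diff sum.distrib sum_subtractf sum_distrib_left ac_simps)
  also have "\<dots> = (\<Sum>i<n. (x i)\<^sup>2) - real n * m\<^sup>2"
    using assms by (simp add: m_def power2_eq_square)
  also have "\<dots> \<le> (\<Sum>i<n. (x i)\<^sup>2)" by simp
  finally show ?thesis unfolding m_def[symmetric] by (subst L2_norm_le_iff_sum_le[OF assms]) simp
qed

text \<open>
  The heart of the matter for uniformly curved spaces. If \<open>A\<close> contracts real mean-zero vectors by the
  factor \<open>r\<close> and \<open>J\<close> is the matrix of averaging, then \<open>T = (A\<^sup>k - J) / 2\<close> has real norm at most \<open>r ^ k\<close>,
  while its absolute value is at most \<open>(A\<^sup>k + J) / 2\<close>, of norm at most 1. For large \<open>k\<close> uniform curvature
  makes \<open>T\<close> small on vectors with values in the space, so \<open>A\<^sup>k\<close> halves mean-zero vectors. Such a vector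
  is therefore moved by \<open>A\<^sup>k\<close> through half of its norm at least, hence by \<open>A\<close> itself through a fixed
  proportion of it. The number \<open>k\<close> depends only on \<open>r\<close> and the space, not on the matrix or its size.
\<close>

lemma uniformly_curved_spectral_gap:
  assumes "uniformly_curved TYPE('y::banach)" and r: "0 \<le> r" "r < 1"
  obtains k :: nat where
    "\<And>n A (y :: nat \<Rightarrow> 'y). 0 < n \<Longrightarrow> doubly_stochastic n A \<Longrightarrow>
      (\<And>x :: nat \<Rightarrow> real. (\<Sum>i<n. x i) = 0 \<Longrightarrow> L2_norm n (tensor_id n A x) \<le> r * L2_norm n x) \<Longrightarrow>
      (\<Sum>i<n. y i) = 0 \<Longrightarrow>
      L2_norm n y \<le> 2 * real k * L2_norm n (\<lambda>i. y i - tensor_id n A y i)"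
proof -
  obtain \<epsilon> where \<epsilon>: "0 < \<epsilon>"
    "\<And>n T. 0 < n \<Longrightarrow> tensor_norm TYPE(real) n T \<le> \<epsilon> \<Longrightarrow> tensor_norm TYPE(real) n (\<lambda>i j. \<bar>T i j\<bar>) \<le> 1
       \<Longrightarrow> tensor_norm TYPE('y) n T \<le> 1 / 4"
    using uniformly_curvedD[OF assms(1), of "1 / 4"] by auto
  obtain k where k: "r ^ k < \<epsilon>"
    using real_arch_pow_inv[OF \<epsilon>(1) r(2)] by blast
  have "L2_norm n y \<le> 2 * real k * L2_norm n (\<lambda>i. y i - tensor_id n A y i)"
    if n: "0 < n" and A: "doubly_stochastic n A"
      and gap: "\<And>x :: nat \<Rightarrow> real. (\<Sum>i<n. x i) = 0 \<Longrightarrow> L2_norm n (tensor_id n A x) \<le> r * L2_norm n x"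
      and y: "(\<Sum>i<n. y i) = 0"
    for n A and y :: "nat \<Rightarrow> 'y"
  proof -
    let ?P = "mat_pow n A k"
    define T where "T = (\<lambda>i j. (?P i j - 1 / real n) / 2)"
    have P: "doubly_stochastic n ?P" by (rule doubly_stochastic_mat_pow[OF A])
    have "tensor_norm TYPE(real) n T \<le> \<epsilon>"
    proof (rule tensor_norm_le)
      fix x :: "nat \<Rightarrow> real"
      define m where "m = (\<Sum>j<n. x j) / real n"
      define z where "z = (\<lambda>i. x i - m)"
      have z0: "(\<Sum>i<n. z i) = 0" using n by (simp add: z_def m_def sum_subtractf)
      have "tensor_id n T x i = (1 / 2) *\<^sub>R (tensor_id n A ^^ k) z i" if i: "i < n" for i
      proof -
        have row: "(\<Sum>j<n. ?P i j) = 1" using P i by (simp add: doubly_stochastic_def)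
        have "tensor_id n ?P z i = (\<Sum>j<n. ?P i j * x j) - (\<Sum>j<n. ?P i j) * m"
          by (simp add: tensor_id_def z_def right_diff_distrib sum_subtractf sum_distrib_right)
        also have "\<dots> = (\<Sum>j<n. ?P i j * x j - 1 / real n * x j)"
          by (simp add: row m_def sum_subtractf sum_divide_distrib)
        also have "\<dots> = 2 * tensor_id n T x i"
          by (simp add: tensor_id_def T_def sum_distrib_left left_diff_distrib diff_divide_distrib)
        finally show ?thesis using tensor_id_mat_pow[OF i, of A k z] by simp
      qed
      then have "L2_norm n (tensor_id n T x) = L2_norm n (\<lambda>i. (1 / 2) *\<^sub>R (tensor_id n A ^^ k) z i)"
        by (intro L2_norm_cong)
      also have "\<dots> = (1 / 2) * L2_norm n ((tensor_id n A ^^ k) z)"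
        by (subst L2_norm_scaleR) simp
      also have "\<dots> \<le> L2_norm n ((tensor_id n A ^^ k) z)"
        using L2_norm_nonneg[of n "(tensor_id n A ^^ k) z"] by simp
      also have "\<dots> \<le> r ^ k * L2_norm n z"
        using mean_zero_iterate[OF A n r(1) gap z0] by blast
      also have "\<dots> \<le> \<epsilon> * L2_norm n x"
        using k L2_norm_centre_le[OF n, of x] r L2_norm_nonneg[of n z] \<epsilon>(1)
        by (intro mult_mono) (auto simp: z_def m_def)
      finally show "L2_norm n (tensor_id n T x) \<le> \<epsilon> * L2_norm n x" .
    qed (use \<epsilon>(1) in simp)
    moreover have "tensor_norm TYPE(real) n (\<lambda>i j. \<bar>T i j\<bar>) \<le> 1"
    proof (rule tensor_norm_le)
      fix x :: "nat \<Rightarrow> real"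
      let ?a = "\<lambda>i. \<bar>x i\<bar>"
      have "L2_norm n (tensor_id n (\<lambda>i j. \<bar>T i j\<bar>) x)
          \<le> L2_norm n (\<lambda>i. (1 / 2) *\<^sub>R (tensor_id n ?P ?a i + (1 / real n) *\<^sub>R (\<Sum>j<n. ?a j)))"
      proof (rule L2_norm_mono)
        fix i assume i: "i < n"
        have Pn: "\<And>j. j < n \<Longrightarrow> 0 \<le> ?P i j" using P i by (simp add: doubly_stochastic_def)
        have "norm (tensor_id n (\<lambda>i j. \<bar>T i j\<bar>) x i) \<le> (\<Sum>j<n. \<bar>T i j\<bar> * \<bar>x j\<bar>)"
          unfolding tensor_id_def by (intro order_trans[OF norm_sum]) (simp add: abs_mult)
        also have "\<dots> \<le> (\<Sum>j<n. (?P i j + 1 / real n) / 2 * \<bar>x j\<bar>)"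
        proof (intro sum_mono mult_right_mono)
          fix j assume "j \<in> {..<n}"
          then have "\<bar>?P i j - 1 / real n\<bar> \<le> ?P i j + 1 / real n"
            using Pn by (intro abs_leI) auto
          then show "\<bar>T i j\<bar> \<le> (?P i j + 1 / real n) / 2" by (simp add: T_def)
        qed simp
        also have "\<dots> = (1 / 2) *\<^sub>R (tensor_id n ?P ?a i + (1 / real n) *\<^sub>R (\<Sum>j<n. ?a j))"
          by (simp add: tensor_id_def add_divide_distrib distrib_right sum.distrib sum_divide_distrib)
        finally show "norm (tensor_id n (\<lambda>i j. \<bar>T i j\<bar>) x i)
          \<le> norm ((1 / 2) *\<^sub>R (tensor_id n ?P ?a i + (1 / real n) *\<^sub>R (\<Sum>j<n. ?a j)))"
          by (rule order_trans) (simp only: real_norm_def abs_ge_self)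
      qed
      also have "\<dots> \<le> (1 / 2) * (L2_norm n (tensor_id n ?P ?a) + L2_norm n (\<lambda>_. (1 / real n) *\<^sub>R (\<Sum>j<n. ?a j)))"
        using L2_norm_triangle[of n "tensor_id n ?P ?a" "\<lambda>_. (1 / real n) *\<^sub>R (\<Sum>j<n. ?a j)"]
        by (subst L2_norm_scaleR) simp
      also have "\<dots> \<le> (1 / 2) * (L2_norm n ?a + L2_norm n ?a)"
        using doubly_stochastic_contraction[OF P n, of ?a] L2_norm_mean_le[OF n, of ?a]
        by (intro mult_left_mono add_mono) auto
      also have "\<dots> = 1 * L2_norm n x" by (simp add: L2_norm_def)
      finally show "L2_norm n (tensor_id n (\<lambda>i j. \<bar>T i j\<bar>) x) \<le> 1 * L2_norm n x" .
    qed simp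
    ultimately have T: "tensor_norm TYPE('y) n T \<le> 1 / 4" using \<epsilon>(2)[OF n] by blast
    have "(tensor_id n A ^^ k) y i = 2 *\<^sub>R tensor_id n T y i" if i: "i < n" for i
    proof -
      have T2: "2 * T i j = ?P i j - 1 / real n" for j by (simp add: T_def)
      have "2 *\<^sub>R tensor_id n T y i = (\<Sum>j<n. (2 * T i j) *\<^sub>R y j)"
        by (simp add: tensor_id_def scaleR_sum_right)
      also have "\<dots> = tensor_id n ?P y i - (1 / real n) *\<^sub>R (\<Sum>j<n. y j)"
        by (simp only: T2 scaleR_diff_left sum_subtractf scaleR_sum_right tensor_id_def)
      finally have "2 *\<^sub>R tensor_id n T y i = tensor_id n ?P y i - (1 / real n) *\<^sub>R (\<Sum>j<n. y j)" .
      then show ?thesis using y tensor_id_mat_pow[OF i, of A k y] by simp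
    qed
    then have "L2_norm n ((tensor_id n A ^^ k) y) = L2_norm n (\<lambda>i. 2 *\<^sub>R tensor_id n T y i)"
      by (intro L2_norm_cong)
    also have "\<dots> = 2 * L2_norm n (tensor_id n T y)"
      by (subst L2_norm_scaleR) simp
    also have "\<dots> \<le> 2 * (1 / 4 * L2_norm n y)"
      using order_trans[OF L2_norm_tensor_id_le[OF n] mult_right_mono[OF T L2_norm_nonneg]]
      by (intro mult_left_mono) auto
    \<comment> \<open>On mean-zero vectors the power of A equals 2 T, whose norm is at most 2 times 1/4.\<close>
    finally have half: "L2_norm n ((tensor_id n A ^^ k) y) \<le> L2_norm n y / 2" by simp
    have "L2_norm n y = L2_norm n (\<lambda>i. (y i - (tensor_id n A ^^ k) y i) + (tensor_id n A ^^ k) y i)"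
      by simp
    also have "\<dots> \<le> L2_norm n (\<lambda>i. y i - (tensor_id n A ^^ k) y i) + L2_norm n ((tensor_id n A ^^ k) y)"
      by (rule L2_norm_triangle)
    finally show ?thesis using half L2_norm_iterate_diff[OF A n, of y k] by simp
  qed
  then show ?thesis by (rule that)
qed


section \<open>The lazy walk on a graph\<close>

definition laplacian :: "('v, 'e) pre_digraph \<Rightarrow> ('v \<Rightarrow> 'x::real_normed_vector) \<Rightarrow> 'v \<Rightarrow> 'x" where
  "laplacian G f v = (\<Sum>a\<in>out_arcs G v. f (head G a) - f v)"

text \<open>
  The transition matrix of the walk on the vertices \<open>e 0, e 1, \<dots>\<close> that follows each oriented edge
  with probability \<open>1 / (2 * D)\<close> and otherwise stays put, where \<open>D\<close> bounds the degrees. Dividing by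
  the uniform \<open>2 * D\<close> rather than by the degree of the current vertex makes the uniform distribution
  stationary also on irregular graphs; the factor 2 makes the matrix positive semidefinite, which
  excludes an eigenvalue close to \<open>-1\<close>.
\<close>

definition lazy_walk :: "('v, 'e) pre_digraph \<Rightarrow> nat \<Rightarrow> (nat \<Rightarrow> 'v) \<Rightarrow> nat \<Rightarrow> nat \<Rightarrow> real" where
  "lazy_walk G D e i j = (if i = j then 1 - real (out_degree G (e i)) / (2 * real D) else 0)
      + real (card {a \<in> out_arcs G (e i). head G a = e j}) / (2 * real D)"

context connected_multigraph
begin

lemma tensor_id_lazy_walk:
  fixes f :: "'v \<Rightarrow> 'x::banach"
  assumes e: "bij_betw e {..<card (verts G)} (verts G)"
    and x: "\<And>j. j < card (verts G) \<Longrightarrow> x j = f (e j)" and i: "i < card (verts G)"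
  shows "tensor_id (card (verts G)) (lazy_walk G D e) x i
    = f (e i) + (1 / (2 * real D)) *\<^sub>R laplacian G f (e i)"
proof -
  define n where "n = card (verts G)"
  have count: "(\<Sum>j<n. real (card {a \<in> out_arcs G (e i). head G a = e j}) *\<^sub>R f (e j))
      = (\<Sum>a\<in>out_arcs G (e i). f (head G a))"
  proof -
    have "(\<Sum>j<n. real (card {a \<in> out_arcs G (e i). head G a = e j}) *\<^sub>R f (e j))
        = (\<Sum>w\<in>verts G. real (card {a \<in> out_arcs G (e i). head G a = w}) *\<^sub>R f w)"
      unfolding n_def by (rule sum.reindex_bij_betw[OF e])
    also have "\<dots> = (\<Sum>w\<in>verts G. \<Sum>a | a \<in> out_arcs G (e i) \<and> head G a = w. f (head G a))"
    proof (rule sum.cong[OF refl])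
      fix w
      have "(\<Sum>a | a \<in> out_arcs G (e i) \<and> head G a = w. f (head G a))
          = (\<Sum>a | a \<in> out_arcs G (e i) \<and> head G a = w. f w)"
        by (rule sum.cong) auto
      then show "real (card {a \<in> out_arcs G (e i). head G a = w}) *\<^sub>R f w =
          (\<Sum>a | a \<in> out_arcs G (e i) \<and> head G a = w. f (head G a))"
        by (simp only: sum_constant_scaleR)
    qed
    also have "\<dots> = (\<Sum>a\<in>out_arcs G (e i). f (head G a))"
      by (rule sum.group) (auto simp: head_in_verts)
    finally show ?thesis .
  qed
  have "tensor_id n (lazy_walk G D e) x i
      = (\<Sum>j<n. (if i = j then (1 - real (out_degree G (e i)) / (2 * real D)) *\<^sub>R x j else 0)
        + (1 / (2 * real D)) *\<^sub>R (real (card {a \<in> out_arcs G (e i). head G a = e j}) *\<^sub>R f (e j)))"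
    unfolding tensor_id_def lazy_walk_def using x
    by (intro sum.cong) (auto simp: scaleR_add_left n_def)
  also have "\<dots> = (1 - real (out_degree G (e i)) / (2 * real D)) *\<^sub>R x i
      + (1 / (2 * real D)) *\<^sub>R (\<Sum>a\<in>out_arcs G (e i). f (head G a))"
    unfolding sum.distrib scaleR_sum_right[symmetric] count using i by (simp add: n_def)
  also have "\<dots> = f (e i) + (1 / (2 * real D)) *\<^sub>R laplacian G f (e i)"
    using x[OF i] unfolding laplacian_def sum_subtractf sum_constant_scaleR out_degree_def[symmetric]
    by (simp add: scaleR_diff_left scaleR_diff_right)
  finally show ?thesis by (simp only: n_def)
qed

lemma doubly_stochastic_lazy_walk:
  assumes e: "bij_betw e {..<card (verts G)} (verts G)"
    and D: "\<And>v. v \<in> verts G \<Longrightarrow> out_degree G v \<le> D" "1 \<le> D"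
  shows "doubly_stochastic (card (verts G)) (lazy_walk G D e)"
proof -
  have rows: "(\<Sum>j<card (verts G). lazy_walk G D e i j) = 1" if "i < card (verts G)" for i
    using tensor_id_lazy_walk[OF e, of "\<lambda>_. 1 :: real" "\<lambda>_. 1" i D] that
    by (simp add: tensor_id_def laplacian_def)
  obtain rev where rev: "\<forall>e\<in>arcs G. rev e \<in> arcs G \<and> rev (rev e) = e \<and>
            tail G (rev e) = head G e \<and> head G (rev e) = tail G e"
    using reversal by blast
  have sym: "lazy_walk G D e i j = lazy_walk G D e j i" for i j
  proof -
    have "bij_betw rev {a \<in> out_arcs G (e i). head G a = e j} {a \<in> out_arcs G (e j). head G a = e i}"
      by (rule bij_betwI[where g = rev]) (use rev in auto)
    then show ?thesis
      unfolding lazy_walk_def using bij_betw_same_card by fastforce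
  qed
  have "0 \<le> lazy_walk G D e i j" if "i < card (verts G)" for i j
  proof -
    have "e i \<in> verts G" using e that by (auto simp: bij_betw_def)
    then have "real (out_degree G (e i)) / (2 * real D) \<le> 1"
      using D(1)[of "e i"] D(2) by (simp add: divide_le_eq)
    then show ?thesis unfolding lazy_walk_def by auto
  qed
  moreover have "(\<Sum>i<card (verts G). lazy_walk G D e i j) = 1" if "j < card (verts G)" for j
    using rows[OF that] by (subst sym)
  ultimately show ?thesis
    using rows by (simp add: doubly_stochastic_def)
qed

lemma laplacian_sq_le_dirichlet:
  fixes f :: "'v \<Rightarrow> 'x::banach"
  assumes deg: "\<And>v. v \<in> verts G \<Longrightarrow> out_degree G v \<le> D"
  shows "(\<Sum>v\<in>verts G. (norm (laplacian G f v))\<^sup>2) \<le> real D * dirichlet G f"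
proof -
  have "(norm (laplacian G f v))\<^sup>2
      \<le> real D * (\<Sum>a\<in>out_arcs G v. (norm (f (head G a) - f v))\<^sup>2)" if v: "v \<in> verts G" for v
  proof -
    have "(norm (laplacian G f v))\<^sup>2
        \<le> real (card (out_arcs G v)) * (\<Sum>a\<in>out_arcs G v. (norm (f (head G a) - f v))\<^sup>2)"
      unfolding laplacian_def by (rule norm_sum_sq_le) auto
    also have "\<dots> \<le> real D * (\<Sum>a\<in>out_arcs G v. (norm (f (head G a) - f v))\<^sup>2)"
      using deg[OF v] by (intro mult_right_mono sum_nonneg) (auto simp: out_degree_def)
    finally show ?thesis .
  qed
  then have "(\<Sum>v\<in>verts G. (norm (laplacian G f v))\<^sup>2)
      \<le> (\<Sum>v\<in>verts G. real D * (\<Sum>a\<in>out_arcs G v. (norm (f (head G a) - f v))\<^sup>2))"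
    by (rule sum_mono)
  then show ?thesis by (simp only: dirichlet_def sum_distrib_left)
qed

text \<open>Pairing each oriented edge with its reversal turns \<open>f v * (f w - f v)\<close> into half of a square.\<close>

lemma sum_mult_laplacian:
  fixes f :: "'v \<Rightarrow> real"
  shows "(\<Sum>v\<in>verts G. f v * laplacian G f v) = - dirichlet G f / 2"
proof -
  have "(\<Sum>v\<in>verts G. f v * laplacian G f v) = (\<Sum>a\<in>arcs G. f (tail G a) * (f (head G a) - f (tail G a)))"
    unfolding laplacian_def sum_distrib_left by (rule sum_out_arcs[of "\<lambda>v w. f v * (f w - f v)"])
  moreover have "\<dots> = (\<Sum>a\<in>arcs G. f (head G a) * (f (tail G a) - f (head G a)))"
    by (rule sum_arcs_reverse[of "\<lambda>v w. f v * (f w - f v)"])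
  moreover have "dirichlet G f = (\<Sum>a\<in>arcs G. (norm (f (head G a) - f (tail G a)))\<^sup>2)"
    unfolding dirichlet_def by (rule sum_out_arcs[of "\<lambda>v w. (norm (f w - f v))\<^sup>2"])
  moreover have "(\<Sum>a\<in>arcs G. (norm (f (head G a) - f (tail G a)))\<^sup>2)
      = - (\<Sum>a\<in>arcs G. f (tail G a) * (f (head G a) - f (tail G a)))
        - (\<Sum>a\<in>arcs G. f (head G a) * (f (tail G a) - f (head G a)))"
    unfolding sum_negf[symmetric] sum_subtractf[symmetric]
    by (intro sum.cong) (auto simp: power2_eq_square algebra_simps)
  ultimately show ?thesis by linarith
qed

text \<open>
  For mean-zero \<open>f\<close>, expanding the square of \<open>f + laplacian G f / (2 * D)\<close> loses
  \<open>dirichlet G f / (2 * D)\<close> in the cross term and regains at most half of that in the last term; the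
  Poincare inequality bounds the net loss below by a multiple of the squared norm of \<open>f\<close>.
\<close>

lemma lazy_walk_gap:
  fixes x :: "nat \<Rightarrow> real"
  assumes e: "bij_betw e {..<card (verts G)} (verts G)"
    and deg: "\<And>v. v \<in> verts G \<Longrightarrow> out_degree G v \<le> D" and D: "1 \<le> D"
    and gap: "poincare TYPE(real) K G" and K: "0 < K"
    and r: "0 \<le> r" "1 - 1 / (4 * real D * K) \<le> r\<^sup>2"
    and x0: "(\<Sum>i<card (verts G). x i) = 0"
  shows "L2_norm (card (verts G)) (tensor_id (card (verts G)) (lazy_walk G D e) x)
    \<le> r * L2_norm (card (verts G)) x"
proof (subst L2_norm_le_iff[OF card_verts_pos r(1)])
  define n where "n = card (verts G)"
  define s where "s = 1 / (4 * real D * K)"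
  have s: "0 \<le> s" using K by (simp add: s_def)
  have sums: "(\<Sum>i<n. h (e i)) = (\<Sum>v\<in>verts G. h v)" for h :: "'v \<Rightarrow> real"
    unfolding n_def by (rule sum.reindex_bij_betw[OF e])
  define f where "f = x \<circ> inv_into {..<n} e"
  have xf: "x j = f (e j)" if "j < n" for j
    using bij_betw_inv_into_left[OF e] that by (simp add: f_def n_def)
  have "(\<Sum>v\<in>verts G. f v) = 0"
    using x0[folded n_def] xf sums[of f] by simp
  then have m0: "vmean G f = 0" by (simp add: vmean_def)
  have "(\<Sum>v\<in>verts G. (norm (f v - vmean G f))\<^sup>2) \<le> K * dirichlet G f"
    using gap unfolding poincare_def by (rule spec)
  then have P: "(\<Sum>v\<in>verts G. (f v)\<^sup>2) \<le> K * dirichlet G f"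
    by (simp add: m0)
  have "(\<Sum>i<n. (norm (tensor_id n (lazy_walk G D e) x i))\<^sup>2)
      = (\<Sum>i<n. (f (e i) + laplacian G f (e i) / (2 * real D))\<^sup>2)"
    using tensor_id_lazy_walk[OF e, of x f _ D] xf by (intro sum.cong) (auto simp: n_def)
  also have "\<dots> = (\<Sum>v\<in>verts G. (f v + laplacian G f v / (2 * real D))\<^sup>2)"
    by (rule sums)
  also have "\<dots> = (\<Sum>v\<in>verts G. (f v)\<^sup>2 + (1 / real D) * (f v * laplacian G f v)
      + (1 / (2 * real D))\<^sup>2 * (laplacian G f v)\<^sup>2)"
    using D by (intro sum.cong) (auto simp: power2_eq_square field_simps)
  also have "\<dots> = (\<Sum>v\<in>verts G. (f v)\<^sup>2) + (1 / real D) * (\<Sum>v\<in>verts G. f v * laplacian G f v)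
      + (1 / (2 * real D))\<^sup>2 * (\<Sum>v\<in>verts G. (laplacian G f v)\<^sup>2)"
    by (simp only: sum.distrib sum_distrib_left)
  also have "\<dots> \<le> (\<Sum>v\<in>verts G. (f v)\<^sup>2) + (1 / real D) * (- dirichlet G f / 2)
      + (1 / (2 * real D))\<^sup>2 * (real D * dirichlet G f)"
    unfolding sum_mult_laplacian using laplacian_sq_le_dirichlet[OF deg, of f]
    by (intro add_left_mono mult_left_mono) auto
  also have "\<dots> = (\<Sum>v\<in>verts G. (f v)\<^sup>2) - dirichlet G f / (4 * real D)"
    using D by (simp add: power2_eq_square field_simps)
  also have "\<dots> \<le> (\<Sum>v\<in>verts G. (f v)\<^sup>2) - s * (\<Sum>v\<in>verts G. (f v)\<^sup>2)"
    using mult_left_mono[OF P s] K D by (simp add: s_def)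
  also have "\<dots> = (1 - s) * (\<Sum>v\<in>verts G. (f v)\<^sup>2)" by (simp add: algebra_simps)
  also have "\<dots> \<le> r\<^sup>2 * (\<Sum>v\<in>verts G. (f v)\<^sup>2)"
    using r(2) by (intro mult_right_mono sum_nonneg) (auto simp: s_def)
  also have "(\<Sum>v\<in>verts G. (f v)\<^sup>2) = (\<Sum>i<n. (norm (x i))\<^sup>2)"
    using xf sums[of "\<lambda>v. (f v)\<^sup>2"] by simp
  finally show "(\<Sum>i<card (verts G). (norm (tensor_id (card (verts G)) (lazy_walk G D e) x i))\<^sup>2)
      \<le> r\<^sup>2 * (\<Sum>i<card (verts G). (norm (x i))\<^sup>2)"
    by (simp only: n_def)
qed

end

text \<open>
  Expanders satisfy a Poincare inequality in every uniformly curved space: by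
  \<open>uniformly_curved_spectral_gap\<close> a mean-zero map is controlled by its displacement under one step of
  the lazy walk, and that displacement is a Laplacian.
\<close>

lemma uniformly_curved_poincare:
  assumes Y: "uniformly_curved TYPE('y::banach)" and K: "0 < K" and D: "1 \<le> D"
  obtains K' where "0 < K'"
    "\<And>G :: ('v, 'e) pre_digraph. connected_multigraph G \<Longrightarrow>
       (\<And>v. v \<in> verts G \<Longrightarrow> out_degree G v \<le> D) \<Longrightarrow> poincare TYPE(real) K G \<Longrightarrow>
       poincare TYPE('y) K' G"
proof -
  define r where "r = sqrt (max 0 (1 - 1 / (4 * real D * K)))"
  have "0 < 1 / (4 * real D * K)" using K D by simp
  then have r: "0 \<le> r" "r < 1" by (auto simp: r_def simp del: divide_pos_pos zero_less_divide_iff)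
  have r2: "1 - 1 / (4 * real D * K) \<le> r\<^sup>2" by (simp add: r_def)
  obtain k :: nat where k: "\<And>n A (y :: nat \<Rightarrow> 'y). 0 < n \<Longrightarrow> doubly_stochastic n A \<Longrightarrow>
      (\<And>x :: nat \<Rightarrow> real. (\<Sum>i<n. x i) = 0 \<Longrightarrow> L2_norm n (tensor_id n A x) \<le> r * L2_norm n x) \<Longrightarrow>
      (\<Sum>i<n. y i) = 0 \<Longrightarrow>
      L2_norm n y \<le> 2 * real k * L2_norm n (\<lambda>i. y i - tensor_id n A y i)"
    using uniformly_curved_spectral_gap[OF Y r] by blast
  define K' where "K' = (2 * real k)\<^sup>2 * (1 / (4 * real D)) + 1"
  have "poincare TYPE('y) K' G"
    if G: "connected_multigraph G" and deg: "\<And>v. v \<in> verts G \<Longrightarrow> out_degree G v \<le> D"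
      and gap: "poincare TYPE(real) K G" for G :: "('v, 'e) pre_digraph"
  proof -
    interpret connected_multigraph G by (rule G)
    define n where "n = card (verts G)"
    have n: "0 < n" using card_verts_pos by (simp add: n_def)
    obtain e where e: "bij_betw e {..<card (verts G)} (verts G)"
      using ex_bij_betw_nat_finite[OF finite_verts] by (auto simp: atLeast0LessThan)
    define A where "A = lazy_walk G D e"
    have sums: "(\<Sum>i<n. h (e i)) = (\<Sum>v\<in>verts G. h v)" for h :: "'v \<Rightarrow> 'z::comm_monoid_add"
      unfolding n_def by (rule sum.reindex_bij_betw[OF e])
    show ?thesis
      unfolding poincare_def
    proof
      fix f0 :: "'v \<Rightarrow> 'y"
      define f where "f = (\<lambda>v. f0 v - vmean G f0)"
      define y where "y = (\<lambda>i. f (e i))"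
      have "vmean G f = 0"
        unfolding f_def by (simp add: vmean_diff_const[OF finite_verts verts_nonempty])
      then have "(\<Sum>v\<in>verts G. f v) = 0"
        using verts_nonempty by (simp add: vmean_def)
      then have y0: "(\<Sum>i<n. y i) = 0" unfolding y_def sums .
      have dir: "dirichlet G f = dirichlet G f0" by (simp add: dirichlet_def f_def)
      have "(\<Sum>v\<in>verts G. (norm (f v))\<^sup>2) = (\<Sum>i<n. (norm (y i))\<^sup>2)"
        unfolding y_def by (rule sums[symmetric])
      also have "\<dots> \<le> (2 * real k)\<^sup>2 * (\<Sum>i<n. (norm (y i - tensor_id n A y i))\<^sup>2)"
      proof (subst L2_norm_le_iff[symmetric])
        show "L2_norm n y \<le> 2 * real k * L2_norm n (\<lambda>i. y i - tensor_id n A y i)"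
        proof (rule k[OF n _ _ y0])
          show "doubly_stochastic n A"
            unfolding n_def A_def using deg D by (intro doubly_stochastic_lazy_walk[OF e])
          show "L2_norm n (tensor_id n A x) \<le> r * L2_norm n x"
            if "(\<Sum>i<n. x i) = 0" for x :: "nat \<Rightarrow> real"
            unfolding n_def A_def
            using lazy_walk_gap[OF e deg D gap K r(1) r2] that[unfolded n_def] by blast
        qed
      qed (use n in auto)
      also have "(\<Sum>i<n. (norm (y i - tensor_id n A y i))\<^sup>2)
          = (\<Sum>i<n. (1 / (2 * real D))\<^sup>2 * (norm (laplacian G f (e i)))\<^sup>2)"
        using tensor_id_lazy_walk[OF e, of y f _ D]
        by (intro sum.cong) (auto simp: y_def n_def A_def power_mult_distrib power_divide)
      also have "\<dots> = (1 / (2 * real D))\<^sup>2 * (\<Sum>v\<in>verts G. (norm (laplacian G f v))\<^sup>2)"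
        unfolding sum_distrib_left by (rule sums)
      also have "(2 * real k)\<^sup>2 * \<dots> \<le> (2 * real k)\<^sup>2 * ((1 / (2 * real D))\<^sup>2 * (real D * dirichlet G f))"
        using laplacian_sq_le_dirichlet[OF deg, of f] by (intro mult_left_mono) auto
      also have "\<dots> = (2 * real k)\<^sup>2 * (1 / (4 * real D)) * dirichlet G f"
        using D by (simp add: power2_eq_square)
      also have "\<dots> \<le> K' * dirichlet G f"
        unfolding K'_def using dirichlet_nonneg[of G f] by (intro mult_right_mono) auto
      finally show "(\<Sum>v\<in>verts G. (norm (f0 v - vmean G f0))\<^sup>2) \<le> K' * dirichlet G f0"
        unfolding dir by (simp add: f_def)
    qed
  qed
  moreover have "0 < K'" by (simp add: K'_def add_nonneg_pos)
  ultimately show ?thesis by (rule that[rotated])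
qed


section \<open>Radial extension of sphere homeomorphisms\<close>

lemma unit_direction_diff_le:
  fixes a b :: "'x::real_normed_vector"
  assumes "a \<noteq> 0" "b \<noteq> 0"
  shows "norm (a /\<^sub>R norm a - b /\<^sub>R norm b) \<le> 2 * norm (a - b) / norm a"
proof -
  have "norm a *\<^sub>R (a /\<^sub>R norm a - b /\<^sub>R norm b) = (a - b) + (norm b - norm a) *\<^sub>R (b /\<^sub>R norm b)"
    using assms by (simp add: algebra_simps)
  then have "norm a * norm (a /\<^sub>R norm a - b /\<^sub>R norm b) = norm ((a - b) + (norm b - norm a) *\<^sub>R (b /\<^sub>R norm b))"
    by (metis abs_norm_cancel norm_scaleR)
  also have "\<dots> \<le> norm (a - b) + norm ((norm b - norm a) *\<^sub>R (b /\<^sub>R norm b))"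
    by (rule norm_triangle_ineq)
  also have "norm ((norm b - norm a) *\<^sub>R (b /\<^sub>R norm b)) = \<bar>norm b - norm a\<bar>"
  proof -
    have "norm (b /\<^sub>R norm b) = 1" using assms by simp
    then show ?thesis by (simp only: norm_scaleR[of "norm b - norm a"] mult_1_right)
  qed
  also have "norm (a - b) + \<bar>norm b - norm a\<bar> \<le> 2 * norm (a - b)"
    using norm_triangle_ineq3[of b a] by (simp add: norm_minus_commute)
  finally show ?thesis using assms by (simp add: le_divide_eq mult.commute)
qed

definition radial_extension :: "('x::real_normed_vector \<Rightarrow> 'y::real_normed_vector) \<Rightarrow> 'x \<Rightarrow> 'y" where
  "radial_extension \<phi> a = (if a = 0 then 0 else norm a *\<^sub>R \<phi> (a /\<^sub>R norm a))"

lemma norm_radial_extension: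
  assumes "\<phi> ` sphere 0 1 \<subseteq> sphere 0 1"
  shows "norm (radial_extension \<phi> a) = norm a"
proof (cases "a = 0")
  case False
  then have "a /\<^sub>R norm a \<in> sphere 0 1" by simp
  then have "norm (\<phi> (a /\<^sub>R norm a)) = 1" using assms by (force simp: dist_norm)
  then show ?thesis using False by (simp add: radial_extension_def)
qed (simp add: radial_extension_def)

lemma radial_extension_inverse:
  assumes "\<phi> ` sphere 0 1 \<subseteq> sphere 0 1" "\<And>x. x \<in> sphere 0 1 \<Longrightarrow> \<psi> (\<phi> x) = x"
  shows "radial_extension \<psi> (radial_extension \<phi> a) = a"
proof (cases "a = 0")
  case False
  then have u: "a /\<^sub>R norm a \<in> sphere 0 1" by simp
  have n: "norm (radial_extension \<phi> a) = norm a" by (rule norm_radial_extension[OF assms(1)])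
  then have "radial_extension \<phi> a \<noteq> 0" using False by auto
  then have "radial_extension \<psi> (radial_extension \<phi> a) = norm a *\<^sub>R \<psi> (radial_extension \<phi> a /\<^sub>R norm a)"
    unfolding radial_extension_def[of \<psi>] using n by simp
  also have "radial_extension \<phi> a /\<^sub>R norm a = \<phi> (a /\<^sub>R norm a)"
    using False by (simp add: radial_extension_def)
  finally show ?thesis using False assms(2)[OF u] by simp
qed (simp add: radial_extension_def)

text \<open>
  The scale-invariant form of uniform continuity on bounded sets. For norm-preserving maps a modulus
  of continuity \<open>\<omega>\<close> at scale \<open>R = max (norm a) (norm b)\<close>, that is a bound \<open>R * \<omega> (norm (a - b) / R)\<close>,
  amounts to such bounds: the first term serves if \<open>a\<close> and \<open>b\<close> are close compared with their norms,
  the second one if they are not. Being linear in the norms, the bounds can be squared and summed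
  over a graph.
\<close>

definition almost_lipschitz :: "('x::real_normed_vector \<Rightarrow> 'y::real_normed_vector) \<Rightarrow> bool" where
  "almost_lipschitz \<Phi> \<longleftrightarrow>
     (\<forall>\<eta>>0. \<exists>C>0. \<forall>a b. norm (\<Phi> a - \<Phi> b) \<le> \<eta> * (norm a + norm b) + C * norm (a - b))"

text \<open>
  If the directions of \<open>a\<close> and \<open>b\<close> are closer than the distance that uniform continuity on the sphere
  assigns to \<open>\<eta>\<close>, their images differ by at most \<open>\<eta>\<close>; otherwise \<open>norm a\<close> itself is at most a multiple
  of \<open>norm (a - b)\<close>. The difference of the norms contributes another \<open>norm (a - b)\<close>.
\<close>

lemma almost_lipschitz_radial_extension:
  assumes sph: "\<phi> ` sphere 0 1 \<subseteq> sphere 0 1" and uc: "uniformly_continuous_on (sphere 0 1) \<phi>"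
  shows "almost_lipschitz (radial_extension \<phi>)"
  unfolding almost_lipschitz_def
proof (intro allI impI)
  fix \<eta> :: real assume \<eta>: "0 < \<eta>"
  obtain d where d: "0 < d" "\<And>x y. x \<in> sphere 0 1 \<Longrightarrow> y \<in> sphere 0 1 \<Longrightarrow> dist x y < d \<Longrightarrow> dist (\<phi> x) (\<phi> y) < \<eta>"
    using uc \<eta> unfolding uniformly_continuous_on_def by (metis dist_commute)
  let ?\<Phi> = "radial_extension \<phi>"
  define C where "C = 1 + 4 / d"
  have C: "1 \<le> C" using d by (simp add: C_def)
  have "norm (?\<Phi> a - ?\<Phi> b) \<le> \<eta> * (norm a + norm b) + C * norm (a - b)" for a b
  proof (cases "a = 0 \<or> b = 0")
    case True
    moreover have "?\<Phi> 0 = 0" by (simp add: radial_extension_def)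
    ultimately have "norm (?\<Phi> a - ?\<Phi> b) = norm (a - b)"
      using norm_radial_extension[OF sph] by auto
    also have "\<dots> \<le> C * norm (a - b)" using C mult_right_mono[of 1 C "norm (a - b)"] by simp
    also have "\<dots> \<le> \<eta> * (norm a + norm b) + C * norm (a - b)" using \<eta> by simp
    finally show ?thesis .
  next
    case False
    then have ab: "a \<noteq> 0" "b \<noteq> 0" by auto
    let ?u = "a /\<^sub>R norm a" and ?v = "b /\<^sub>R norm b"
    have uv: "?u \<in> sphere 0 1" "?v \<in> sphere 0 1" using ab by simp_all
    then have \<phi>1: "norm (\<phi> ?u) = 1" "norm (\<phi> ?v) = 1" using sph by (force simp: dist_norm)+
    have "norm a * norm (\<phi> ?u - \<phi> ?v) \<le> \<eta> * norm a + (4 / d) * norm (a - b)"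
    proof (cases "dist ?u ?v < d")
      case True
      then have "norm (\<phi> ?u - \<phi> ?v) \<le> \<eta>" using d(2)[OF uv] by (simp add: dist_norm)
      then have "norm a * norm (\<phi> ?u - \<phi> ?v) \<le> norm a * \<eta>" by (intro mult_left_mono) auto
      moreover have "0 \<le> (4 / d) * norm (a - b)" using d by simp
      ultimately show ?thesis by (simp add: mult.commute)
    next
      case False
      then have "d \<le> 2 * norm (a - b) / norm a"
        using unit_direction_diff_le[OF ab] by (simp add: dist_norm)
      then have na: "norm a \<le> (2 / d) * norm (a - b)"
        using ab d(1) by (simp add: field_simps)
      have "norm (\<phi> ?u - \<phi> ?v) \<le> 2"
        using norm_triangle_ineq4[of "\<phi> ?u" "\<phi> ?v"] \<phi>1 by simp
      then have "norm a * norm (\<phi> ?u - \<phi> ?v) \<le> norm a * 2" by (intro mult_left_mono) auto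
      also have "\<dots> \<le> (4 / d) * norm (a - b)" using na by simp
      also have "\<dots> \<le> \<eta> * norm a + (4 / d) * norm (a - b)" using \<eta> by simp
      finally show ?thesis .
    qed
    moreover have "norm (?\<Phi> a - ?\<Phi> b) \<le> norm a * norm (\<phi> ?u - \<phi> ?v) + norm (a - b)"
    proof -
      have "?\<Phi> a - ?\<Phi> b = norm a *\<^sub>R (\<phi> ?u - \<phi> ?v) + (norm a - norm b) *\<^sub>R \<phi> ?v"
        using ab by (simp add: radial_extension_def algebra_simps)
      then have "norm (?\<Phi> a - ?\<Phi> b) \<le> norm (norm a *\<^sub>R (\<phi> ?u - \<phi> ?v)) + norm ((norm a - norm b) *\<^sub>R \<phi> ?v)"
        by (simp only: norm_triangle_ineq)
      then show ?thesis using \<phi>1 norm_triangle_ineq3[of a b] by simp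
    qed
    ultimately have "norm (?\<Phi> a - ?\<Phi> b) \<le> \<eta> * norm a + C * norm (a - b)"
      by (simp add: C_def distrib_right)
    moreover have "0 \<le> \<eta> * norm b" using \<eta> by simp
    ultimately show ?thesis by (simp add: distrib_left)
  qed
  then show "\<exists>C>0. \<forall>a b. norm (?\<Phi> a - ?\<Phi> b) \<le> \<eta> * (norm a + norm b) + C * norm (a - b)"
    using C by (intro exI[of _ C]) auto
qed

lemma sphere_equivalent_radial:
  assumes "sphere_equivalent TYPE('x::banach) TYPE('y::banach)"
  obtains \<Phi> :: "'x::banach \<Rightarrow> 'y::banach" and \<Psi> :: "'y \<Rightarrow> 'x"
  where "\<And>a. norm (\<Phi> a) = norm a" "\<And>a. \<Psi> (\<Phi> a) = a" "almost_lipschitz \<Phi>" "almost_lipschitz \<Psi>"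
proof -
  obtain \<phi> :: "'x \<Rightarrow> 'y" and \<psi> where h: "homeomorphism (sphere 0 1) (sphere 0 1) \<phi> \<psi>"
    "uniformly_continuous_on (sphere 0 1) \<phi>" "uniformly_continuous_on (sphere 0 1) \<psi>"
    using assms unfolding sphere_equivalent_def by blast
  have s: "\<phi> ` sphere 0 1 \<subseteq> sphere 0 1" "\<psi> ` sphere 0 1 \<subseteq> sphere 0 1"
    and i: "\<And>x. x \<in> sphere 0 1 \<Longrightarrow> \<psi> (\<phi> x) = x"
    using h(1) unfolding homeomorphism_def by auto
  show ?thesis
  proof (rule that)
    show "norm (radial_extension \<phi> a) = norm a" for a
      by (rule norm_radial_extension[OF s(1)])
    show "radial_extension \<psi> (radial_extension \<phi> a) = a" for a
      by (rule radial_extension_inverse[OF s(1) i])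
    show "almost_lipschitz (radial_extension \<phi>)" "almost_lipschitz (radial_extension \<psi>)"
      using almost_lipschitz_radial_extension s h(2,3) by blast+
  qed
qed

text \<open>
  The transfer of the Poincare inequality along a sphere equivalence. Let \<open>f\<close> have mean 0 and let
  \<open>g = \<Phi> \<circ> f\<close>, which has the same pointwise norms; let \<open>S\<close> be the sum of their squares and \<open>E\<close> the
  Dirichlet form of \<open>f\<close>. The Dirichlet form of \<open>g\<close> is at most a small multiple of \<open>S\<close> plus a multiple of
  \<open>E\<close>, so by the Poincare inequality for \<open>g\<close> the map \<open>g\<close> is close in mean square to its mean \<open>y\<close>. Applying
  \<open>\<Psi>\<close>, the map \<open>f = \<Psi> \<circ> g\<close> is close in mean square to the constant \<open>\<Psi> y\<close>. But \<open>f\<close> has mean 0, and no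
  constant is a much better centre than the mean, so \<open>S\<close> is at most a small multiple of \<open>S\<close> plus a
  multiple of \<open>E\<close>.
\<close>

lemma sphere_equivalent_poincare:
  assumes eq: "sphere_equivalent TYPE('x::banach) TYPE('y::banach)" and K: "0 < K"
  obtains K' where "0 < K'"
    "\<And>G :: ('v, 'e) pre_digraph. connected_multigraph G \<Longrightarrow>
       (\<And>v. v \<in> verts G \<Longrightarrow> out_degree G v \<le> D) \<Longrightarrow> poincare TYPE('y) K G \<Longrightarrow>
       poincare TYPE('x) K' G"
proof -
  obtain \<Phi> :: "'x \<Rightarrow> 'y" and \<Psi> :: "'y \<Rightarrow> 'x"
    where norm_\<Phi>: "\<And>a. norm (\<Phi> a) = norm a" and inv: "\<And>a. \<Psi> (\<Phi> a) = a"
      and \<Phi>: "almost_lipschitz \<Phi>" and \<Psi>: "almost_lipschitz \<Psi>"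
    using sphere_equivalent_radial[OF eq] by blast
  \<comment> \<open>The tolerance 1/10 for the map back costs 24/100 of S in the final estimate.\<close>
  obtain C' where C': "0 < C'"
    "\<And>a b. norm (\<Psi> a - \<Psi> b) \<le> 1 / 10 * (norm a + norm b) + C' * norm (a - b)"
    using \<Psi> unfolding almost_lipschitz_def by (metis zero_less_divide_1_iff zero_less_numeral)
  \<comment> \<open>The tolerance for the map forth, chosen after the constant of the map back, costs at most 1/4 of S.\<close>
  define \<eta> where "\<eta> = 1 / sqrt (288 * C'\<^sup>2 * K * (real D + 1))"
  have pos: "0 < 288 * C'\<^sup>2 * K * (real D + 1)" using C'(1) K by simp
  then have \<eta>: "0 < \<eta>" by (simp add: \<eta>_def)
  have \<eta>2: "288 * C'\<^sup>2 * K * (real D + 1) * \<eta>\<^sup>2 = 1"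
    using pos C'(1) K by (simp add: \<eta>_def power_divide)
  obtain C where C: "0 < C"
    "\<And>a b. norm (\<Phi> a - \<Phi> b) \<le> \<eta> * (norm a + norm b) + C * norm (a - b)"
    using \<Phi> \<eta> unfolding almost_lipschitz_def by metis
  define K' where "K' = 72 * C'\<^sup>2 * C\<^sup>2 * K"
  have "poincare TYPE('x) K' G"
    if G: "connected_multigraph G" and deg: "\<And>v. v \<in> verts G \<Longrightarrow> out_degree G v \<le> D"
      and gap: "poincare TYPE('y) K G" for G :: "('v, 'e) pre_digraph"
    unfolding poincare_def
  proof
    interpret connected_multigraph G by (rule G)
    fix f0 :: "'v \<Rightarrow> 'x"
    define f where "f = (\<lambda>v. f0 v - vmean G f0)"
    have f0: "vmean G f = 0"
      unfolding f_def by (simp add: vmean_diff_const[OF finite_verts verts_nonempty])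
    have dir: "dirichlet G f = dirichlet G f0" by (simp add: dirichlet_def f_def)
    define g where "g = (\<lambda>v. \<Phi> (f v))"
    define y where "y = vmean G g"
    define S where "S = (\<Sum>v\<in>verts G. (norm (f v))\<^sup>2)"
    define E where "E = dirichlet G f"
    define R where "R = (\<Sum>v\<in>verts G. (norm (g v - y))\<^sup>2)"
    have S0: "0 \<le> S" unfolding S_def by (intro sum_nonneg) simp
    have Sg: "(\<Sum>v\<in>verts G. (norm (g v))\<^sup>2) = S" by (simp add: S_def g_def norm_\<Phi>)
    have ny: "real (card (verts G)) * (norm y)\<^sup>2 \<le> S"
      unfolding y_def Sg[symmetric] by (rule vmean_norm_sq_le[OF finite_verts verts_nonempty])
    have "R \<le> K * dirichlet G g"
      using gap unfolding R_def y_def poincare_def by blast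
    also have "dirichlet G g \<le> 3 * \<eta>\<^sup>2 * (2 * (real D * S)) + 3 * C\<^sup>2 * E"
    proof -
      have "dirichlet G g \<le> (\<Sum>v\<in>verts G. \<Sum>e\<in>out_arcs G v. 3 * \<eta>\<^sup>2 * (norm (f v))\<^sup>2
          + 3 * \<eta>\<^sup>2 * (norm (f (head G e)))\<^sup>2 + 3 * C\<^sup>2 * (norm (f (head G e) - f v))\<^sup>2)"
        unfolding dirichlet_def
      proof (intro sum_mono)
        fix v e
        have "norm (g (head G e) - g v) \<le> \<eta> * norm (f v) + \<eta> * norm (f (head G e)) + C * norm (f (head G e) - f v)"
          using C(2)[of "f (head G e)" "f v"] by (simp add: g_def distrib_left)
        then have "(norm (g (head G e) - g v))\<^sup>2
            \<le> (\<eta> * norm (f v) + \<eta> * norm (f (head G e)) + C * norm (f (head G e) - f v))\<^sup>2"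
          by (intro power_mono) auto
        also have "\<dots> \<le> 3 * (\<eta> * norm (f v))\<^sup>2 + 3 * (\<eta> * norm (f (head G e)))\<^sup>2 + 3 * (C * norm (f (head G e) - f v))\<^sup>2"
          by (rule sum_three_sq_le)
        finally show "(norm (g (head G e) - g v))\<^sup>2 \<le> 3 * \<eta>\<^sup>2 * (norm (f v))\<^sup>2
          + 3 * \<eta>\<^sup>2 * (norm (f (head G e)))\<^sup>2 + 3 * C\<^sup>2 * (norm (f (head G e) - f v))\<^sup>2"
          by (simp add: power_mult_distrib mult.assoc)
      qed
      also have "\<dots> = 3 * \<eta>\<^sup>2 * (\<Sum>v\<in>verts G. \<Sum>e\<in>out_arcs G v. (norm (f v))\<^sup>2)
          + 3 * \<eta>\<^sup>2 * (\<Sum>v\<in>verts G. \<Sum>e\<in>out_arcs G v. (norm (f (head G e)))\<^sup>2) + 3 * C\<^sup>2 * E"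
        unfolding E_def dirichlet_def by (simp only: sum.distrib sum_distrib_left)
      also have "\<dots> \<le> 3 * \<eta>\<^sup>2 * (real D * S) + 3 * \<eta>\<^sup>2 * (real D * S) + 3 * C\<^sup>2 * E"
        unfolding S_def
        using sum_out_arcs_tail_le[of D "\<lambda>v. (norm (f v))\<^sup>2"] sum_out_arcs_head_le[of D "\<lambda>v. (norm (f v))\<^sup>2"] deg
        by (intro add_mono mult_left_mono) auto
      finally show ?thesis by (simp add: ac_simps)
    qed
    finally have R: "R \<le> K * (3 * \<eta>\<^sup>2 * (2 * (real D * S)) + 3 * C\<^sup>2 * E)"
      using K by simp
    have "(\<Sum>v\<in>verts G. (norm (f v - \<Psi> y))\<^sup>2)
        \<le> (\<Sum>v\<in>verts G. 3 / 100 * (norm (g v))\<^sup>2 + 3 / 100 * (norm y)\<^sup>2 + 3 * C'\<^sup>2 * (norm (g v - y))\<^sup>2)"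
    proof (rule sum_mono)
      fix v
      have "norm (f v - \<Psi> y) \<le> 1 / 10 * norm (g v) + 1 / 10 * norm y + C' * norm (g v - y)"
        using C'(2)[of "g v" y] by (simp add: g_def inv add_divide_distrib)
      then have "(norm (f v - \<Psi> y))\<^sup>2 \<le> (1 / 10 * norm (g v) + 1 / 10 * norm y + C' * norm (g v - y))\<^sup>2"
        by (intro power_mono) auto
      also have "\<dots> \<le> 3 * (1 / 10 * norm (g v))\<^sup>2 + 3 * (1 / 10 * norm y)\<^sup>2 + 3 * (C' * norm (g v - y))\<^sup>2"
        by (rule sum_three_sq_le)
      finally show "(norm (f v - \<Psi> y))\<^sup>2
          \<le> 3 / 100 * (norm (g v))\<^sup>2 + 3 / 100 * (norm y)\<^sup>2 + 3 * C'\<^sup>2 * (norm (g v - y))\<^sup>2"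
        by (simp add: power_mult_distrib power_divide mult.assoc)
    qed
    also have "\<dots> = 3 / 100 * S + 3 / 100 * (real (card (verts G)) * (norm y)\<^sup>2) + 3 * C'\<^sup>2 * R"
      unfolding Sg[symmetric] R_def sum.distrib sum_distrib_left by simp
    also have "\<dots> \<le> 6 / 100 * S + 3 * C'\<^sup>2 * R"
      using ny by simp
    finally have "S \<le> 24 / 100 * S + 12 * C'\<^sup>2 * R"
      using vmean_is_almost_optimal[OF finite_verts verts_nonempty, of f "\<Psi> y"] by (simp add: f0 S_def)
    also have "12 * C'\<^sup>2 * R \<le> 12 * C'\<^sup>2 * (K * (3 * \<eta>\<^sup>2 * (2 * (real D * S)) + 3 * C\<^sup>2 * E))"
      using R by (intro mult_left_mono) auto
    also have "\<dots> = (72 * C'\<^sup>2 * K * real D * \<eta>\<^sup>2) * S + 36 * C'\<^sup>2 * C\<^sup>2 * K * E"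
      by (simp add: algebra_simps)
    also have "(72 * C'\<^sup>2 * K * real D * \<eta>\<^sup>2) * S \<le> 1 / 4 * S"
    proof (rule mult_right_mono[OF _ S0])
      have "72 * C'\<^sup>2 * K * real D * \<eta>\<^sup>2 \<le> 72 * C'\<^sup>2 * K * (real D + 1) * \<eta>\<^sup>2"
        using K by (intro mult_right_mono mult_left_mono) auto
      also have "\<dots> = 1 / 4" using \<eta>2 by simp
      finally show "72 * C'\<^sup>2 * K * real D * \<eta>\<^sup>2 \<le> 1 / 4" .
    qed
    finally have "S \<le> K' * E" using S0 by (simp add: K'_def)
    then show "(\<Sum>v\<in>verts G. (norm (f0 v - vmean G f0))\<^sup>2) \<le> K' * dirichlet G f0"
      unfolding dir[symmetric] by (simp add: S_def E_def f_def)
  qed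
  moreover have "0 < K'" using C C' K by (simp add: K'_def)
  ultimately show ?thesis by (rule that[rotated])
qed


section \<open>Separated vectors\<close>

text \<open>
  By induction, adding one vector \<open>b\<close> at a time: if
  \<open>b\<close> lies at distance \<open>d > 0\<close> from the old subspace, then its coefficient is bounded by the norm
  divided by \<open>d\<close>, so the coefficients of a Cauchy sequence form a Cauchy sequence.
\<close>

lemma complete_span_finite:
  fixes B :: "'x::banach set"
  assumes "finite B"
  shows "complete (span B)"
  using assms
proof (induction B)
  case empty
  show ?case by (simp add: compact_imp_complete)
next
  case (insert b B)
  show ?case
  proof (cases "b \<in> span B")
    case True
    then show ?thesis using insert.IH by (simp add: span_redundant)
  next
    case False
    define d where "d = infdist b (span B)"
    have closed: "closed (span B)" using insert.IH by (simp add: complete_imp_closed)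
    have d: "0 < d"
      unfolding d_def using infdist_pos_not_in_closed[OF closed _ False] span_zero by auto
    have coeff: "\<bar>t\<bar> * d \<le> norm (s + t *\<^sub>R b)" if s: "s \<in> span B" for s t
    proof (cases "t = 0")
      case False
      have "d \<le> dist b ((- 1 / t) *\<^sub>R s)"
        unfolding d_def by (intro infdist_le span_scale s)
      then have "\<bar>t\<bar> * d \<le> norm (t *\<^sub>R (b - (- 1 / t) *\<^sub>R s))"
        by (simp add: dist_norm mult_left_mono)
      also have "t *\<^sub>R (b - (- 1 / t) *\<^sub>R s) = s + t *\<^sub>R b"
        using False by (simp add: algebra_simps)
      finally show ?thesis .
    qed simp
    show ?thesis
    proof (rule completeI)
      fix u assume u: "\<forall>n. u n \<in> span (insert b B)" and "Cauchy u"
      have "\<forall>n. \<exists>k. u n - k *\<^sub>R b \<in> span B"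
        using u by (simp add: span_breakdown_eq)
      then obtain t where t: "\<And>n. u n - t n *\<^sub>R b \<in> span B" by metis
      have "Cauchy t"
      proof (rule metric_CauchyI)
        fix e :: real assume e: "0 < e"
        obtain M where M: "\<And>m n. m \<ge> M \<Longrightarrow> n \<ge> M \<Longrightarrow> dist (u m) (u n) < e * d"
          using metric_CauchyD[OF \<open>Cauchy u\<close>, of "e * d"] e d by auto
        have "dist (t m) (t n) < e" if "m \<ge> M" "n \<ge> M" for m n
        proof -
          have "(u m - t m *\<^sub>R b) - (u n - t n *\<^sub>R b) \<in> span B"
            by (intro span_diff t)
          from coeff[OF this, of "t m - t n"]
          have "\<bar>t m - t n\<bar> * d \<le> dist (u m) (u n)"
            by (simp add: dist_norm algebra_simps)
          also have "\<dots> < e * d" using M that by simp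
          finally show ?thesis using d by (simp add: dist_real_def)
        qed
        then show "\<exists>M. \<forall>m\<ge>M. \<forall>n\<ge>M. dist (t m) (t n) < e" by blast
      qed
      then obtain a where a: "t \<longlonglongrightarrow> a" using Cauchy_convergent convergent_def by blast
      obtain x where x: "u \<longlonglongrightarrow> x" using \<open>Cauchy u\<close> Cauchy_convergent convergent_def by blast
      have lim: "(\<lambda>n. u n - t n *\<^sub>R b) \<longlonglongrightarrow> x - a *\<^sub>R b"
        by (rule tendsto_diff[OF x tendsto_scaleR[OF a tendsto_const]])
      have "x - a *\<^sub>R b \<in> span B"
        by (rule closed_sequentially[OF closed t lim])
      then have "x \<in> span (insert b B)"
        unfolding span_breakdown_eq by (rule exI)
      then show "\<exists>l\<in>span (insert b B). u \<longlonglongrightarrow> l"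
        using x by (rule bexI[rotated])
    qed
  qed
qed

text \<open>
  Riesz's lemma. Dividing \<open>z - s0\<close> by its norm, which is less than twice the distance of \<open>z\<close> from the
  subspace, leaves a vector at distance more than 1/2 from it.
\<close>

lemma riesz_unit_vector:
  fixes S :: "'x::real_normed_vector set"
  assumes "subspace S" "closed S" "S \<noteq> UNIV"
  shows "\<exists>x. norm x = 1 \<and> (\<forall>s\<in>S. 1 / 2 \<le> dist x s)"
proof -
  obtain z where z: "z \<notin> S" using assms(3) by blast
  have S: "S \<noteq> {}" using assms(1) subspace_0 by blast
  define d where "d = infdist z S"
  have d: "0 < d" unfolding d_def using infdist_pos_not_in_closed[OF assms(2) S z] .
  obtain s0 where s0: "s0 \<in> S" "dist z s0 < 2 * d"
  proof -
    have "\<exists>s\<in>S. dist z s < 2 * d"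
      using d S cInf_lessD[of "dist z ` S" "2 * d"] by (auto simp: d_def infdist_notempty)
    then show ?thesis using that by blast
  qed
  define r where "r = norm (z - s0)"
  have r: "0 < r" "r < 2 * d" using z s0 by (auto simp: r_def dist_norm)
  show ?thesis
  proof (rule exI[where x = "(1 / r) *\<^sub>R (z - s0)"], intro conjI ballI)
    show "norm ((1 / r) *\<^sub>R (z - s0)) = 1" using r by (simp add: r_def)
    fix s assume s: "s \<in> S"
    have "d \<le> dist z (s0 + r *\<^sub>R s)"
      unfolding d_def by (intro infdist_le subspace_add[OF assms(1)] subspace_scale[OF assms(1)] s s0(1))
    also have "dist z (s0 + r *\<^sub>R s) = norm (r *\<^sub>R ((1 / r) *\<^sub>R (z - s0) - s))"
      using r by (simp add: dist_norm algebra_simps)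
    also have "\<dots> = r * dist ((1 / r) *\<^sub>R (z - s0)) s"
      using r by (simp add: dist_norm)
    finally have "d \<le> r * dist ((1 / r) *\<^sub>R (z - s0)) s" .
    then have "r * (1 / 2) \<le> r * dist ((1 / r) *\<^sub>R (z - s0)) s" using r(2) by linarith
    then show "1 / 2 \<le> dist ((1 / r) *\<^sub>R (z - s0)) s" using r by (simp only: mult_le_cancel_left_pos)
  qed
qed

lemma separated_unit_vectors:
  assumes "infinite_dimensional TYPE('x::banach)"
  shows "\<exists>F :: 'x set. finite F \<and> card F = N \<and> F \<subseteq> sphere 0 1 \<and> pairwise (\<lambda>x y. 1 / 2 \<le> dist x y) F"
proof (induction N)
  case 0
  show ?case by (rule exI[where x = "{}"]) simp
next
  case (Suc N)
  obtain F :: "'x set" where F: "finite F" "card F = N" "F \<subseteq> sphere 0 1"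
    "pairwise (\<lambda>x y. 1 / 2 \<le> dist x y) F" using Suc by blast
  have ne: "span F \<noteq> UNIV" using assms F(1) unfolding infinite_dimensional_def by blast
  have cl: "closed (span F)" using complete_span_finite[OF F(1)] by (rule complete_imp_closed)
  obtain x where x: "norm x = 1 \<and> (\<forall>s\<in>span F. 1 / 2 \<le> dist x s)"
    using riesz_unit_vector[OF subspace_span cl ne] ..
  have xF: "1 / 2 \<le> dist x s" if "s \<in> F" for s
    using x span_base[OF that] by blast
  have "x \<notin> F"
  proof
    assume "x \<in> F"
    then have "1 / 2 \<le> dist x x" by (rule xF)
    then show False by simp
  qed
  then have "card (insert x F) = Suc N" using F(1,2) by simp
  moreover have "pairwise (\<lambda>x y. 1 / 2 \<le> dist x y) (insert x F)"
    using F(4) xF by (simp add: pairwise_insert dist_commute)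
  moreover have "insert x F \<subseteq> sphere 0 1" using F(3) x by simp
  moreover have "finite (insert x F)" using F(1) by simp
  ultimately show ?case by blast
qed


section \<open>The path metric\<close>

context connected_multigraph
begin

lemma path_dist_le_iff:
  assumes "u \<in> verts G" "v \<in> verts G"
  shows "path_dist G u v \<le> r \<longleftrightarrow> (\<exists>p. awalk u p v \<and> length p \<le> r)"
proof
  have "\<exists>k p. awalk u p v \<and> length p = k"
    using strongly_conn assms unfolding strongly_connected_def reachable_awalk by blast
  then have "\<exists>p. awalk u p v \<and> length p = path_dist G u v"
    unfolding path_dist_def by (rule LeastI_ex)
  then show "path_dist G u v \<le> r \<Longrightarrow> \<exists>p. awalk u p v \<and> length p \<le> r" by auto
next
  assume "\<exists>p. awalk u p v \<and> length p \<le> r"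
  then obtain p where p: "awalk u p v" "length p \<le> r" by blast
  have "path_dist G u v \<le> length p"
    unfolding path_dist_def by (rule Least_le) (use p in blast)
  then show "path_dist G u v \<le> r" using p(2) by simp
qed

lemma awalk_reverse:
  assumes "awalk u p v"
  shows "\<exists>q. awalk v q u \<and> length q = length p"
proof -
  obtain rev where rev: "\<forall>e\<in>arcs G. rev e \<in> arcs G \<and> rev (rev e) = e \<and>
            tail G (rev e) = head G e \<and> head G (rev e) = tail G e"
    using reversal by blast
  show ?thesis
    using assms
  proof (induction p arbitrary: u)
    case Nil
    then show ?case by (auto simp: awalk_Nil_iff)
  next
    case (Cons e p)
    then have e: "e \<in> arcs G" "u = tail G e" "awalk (head G e) p v"
      by (auto simp: awalk_Cons_iff)
    obtain q where q: "awalk v q (head G e)" "length q = length p"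
      using Cons.IH[OF e(3)] by blast
    have "awalk (head G e) [rev e] u"
      using e rev by (auto simp: awalk_Cons_iff awalk_Nil_iff)
    then show ?case using q by (intro exI[of _ "q @ [rev e]"]) (auto intro: awalk_appendI)
  qed
qed

lemma path_dist_sym:
  assumes "u \<in> verts G" "v \<in> verts G"
  shows "path_dist G u v = path_dist G v u"
proof -
  have "path_dist G u v \<le> r \<longleftrightarrow> path_dist G v u \<le> r" for r
    unfolding path_dist_le_iff[OF assms] path_dist_le_iff[OF assms(2,1)]
    by (metis awalk_reverse)
  then show ?thesis by (metis order_antisym order_refl)
qed

lemma path_dist_triangle:
  assumes "u \<in> verts G" "v \<in> verts G" "w \<in> verts G"
  shows "path_dist G u w \<le> path_dist G u v + path_dist G v w"
proof -
  obtain p q where "awalk u p v" "length p \<le> path_dist G u v"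
    "awalk v q w" "length q \<le> path_dist G v w"
    using path_dist_le_iff assms by (meson order_refl)
  then show ?thesis
    unfolding path_dist_le_iff[OF assms(1,3)]
    by (intro exI[of _ "p @ q"]) (auto intro: awalk_appendI)
qed

lemma path_dist_arc_le: "e \<in> arcs G \<Longrightarrow> path_dist G (tail G e) (head G e) \<le> 1"
  by (subst path_dist_le_iff) (auto intro!: exI[of _ "[e]"] simp: awalk_Cons_iff awalk_Nil_iff)

lemma path_dist_pos:
  assumes "u \<in> verts G" "v \<in> verts G" "u \<noteq> v"
  shows "1 \<le> path_dist G u v"
proof (rule ccontr)
  assume "\<not> ?thesis"
  then have "path_dist G u v \<le> 0" by simp
  then obtain p where "awalk u p v" "length p \<le> 0"
    using path_dist_le_iff[OF assms(1,2), of 0] by blast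
  then show False using assms(3) by (simp add: awalk_Nil_iff)
qed

lemma finite_path_dists: "finite {path_dist G u v | u v. u \<in> verts G \<and> v \<in> verts G}"
proof -
  have "{path_dist G u v | u v. u \<in> verts G \<and> v \<in> verts G}
      = (\<lambda>(u, v). path_dist G u v) ` (verts G \<times> verts G)" by auto
  then show ?thesis by simp
qed

lemma path_dist_le_diam: "u \<in> verts G \<Longrightarrow> v \<in> verts G \<Longrightarrow> path_dist G u v \<le> diam G"
  unfolding diam_def by (rule Max_ge[OF finite_path_dists]) auto

lemma diam_le:
  assumes "\<And>u v. u \<in> verts G \<Longrightarrow> v \<in> verts G \<Longrightarrow> path_dist G u v \<le> r"
  shows "diam G \<le> r"
proof -
  obtain u where "u \<in> verts G" using verts_nonempty by blast
  then have "{path_dist G u v | u v. u \<in> verts G \<and> v \<in> verts G} \<noteq> {}" by blast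
  then show ?thesis
    unfolding diam_def using assms by (subst Max_le_iff[OF finite_path_dists]) auto
qed

end


section \<open>The upper bound on the distortion\<close>

context connected_multigraph
begin

text \<open>
  Distinct vertices are at distance between 1 and the diameter, and distinct vectors of a
  1/2-separated set of unit vectors are at distance between 1/2 and 2, so every bijection between
  them has distortion at most four times the diameter.
\<close>

lemma distortion_le_diam:
  assumes "infinite_dimensional TYPE('x::banach)"
  shows "distortion TYPE('x) G \<le> ennreal (4 * real (diam G))"
proof -
  obtain F :: "'x set" where F: "finite F" "card F = card (verts G)" "F \<subseteq> sphere 0 1"
    "pairwise (\<lambda>x y. 1 / 2 \<le> dist x y) F"
    using separated_unit_vectors[OF assms] by blast
  obtain f where f: "bij_betw f (verts G) F"
    using finite_same_card_bij[OF finite_verts F(1)] F(2) by metis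
  have inj: "inj_on f (verts G)" and img: "f ` verts G = F"
    using f by (auto simp: bij_betw_def)
  have L: "lip_graph G f \<le> ennreal 2"
    unfolding lip_graph_def lip_norm_def
  proof (intro SUP_least, clarify)
    fix u v assume uv: "u \<in> verts G" "v \<in> verts G" "u \<noteq> v"
    have "dist (f u) (f v) \<le> norm (f u) + norm (f v)" by (simp add: dist_norm norm_triangle_ineq4)
    also have "\<dots> = 2"
    proof -
      have "f u \<in> sphere 0 1" "f v \<in> sphere 0 1" using F(3) img uv(1,2) by blast+
      then show ?thesis by simp
    qed
    also have "2 \<le> 2 * real (path_dist G u v)" using path_dist_pos[OF uv] by simp
    finally show "ennreal (dist (f u) (f v) / real (path_dist G u v)) \<le> ennreal 2"
      using path_dist_pos[OF uv] by (intro ennreal_leI) (simp add: divide_le_eq)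
  qed
  have M: "lip_graph_inv G f \<le> ennreal (2 * real (diam G))"
    unfolding lip_graph_inv_def lip_norm_def
  proof (intro SUP_least, clarify)
    fix u v assume uv: "u \<in> verts G" "v \<in> verts G" "f u \<noteq> f v"
    have d: "1 / 2 \<le> dist (f u) (f v)" using pairwiseD[OF F(4), of "f u" "f v"] img uv by blast
    have "real (path_dist G u v) \<le> real (diam G) * 1" using path_dist_le_diam uv by simp
    also have "\<dots> \<le> real (diam G) * (2 * dist (f u) (f v))"
      using d by (intro mult_left_mono) auto
    finally show "ennreal (real (path_dist G (inv_into (verts G) f (f u)) (inv_into (verts G) f (f v)))
        / dist (f u) (f v)) \<le> ennreal (2 * real (diam G))"
      using d uv by (intro ennreal_leI) (simp add: inv_into_f_f[OF inj] divide_le_eq mult_ac)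
  qed
  have "bi_lipschitz G f"
    using inj L M by (auto simp: bi_lipschitz_def intro: le_less_trans)
  then have "distortion TYPE('x) G \<le> lip_graph G f * lip_graph_inv G f"
    unfolding distortion_def by (intro INF_lower) simp
  also have "\<dots> \<le> ennreal 2 * ennreal (2 * real (diam G))"
    by (intro mult_mono L M) auto
  also have "\<dots> = ennreal (4 * real (diam G))"
    by (subst ennreal_mult[symmetric]) auto
  finally show ?thesis .
qed

end


section \<open>Growth of balls and the lower bound on the distortion\<close>

lemma lip_normD:
  assumes "lip_norm dA dB A f = ennreal l" "0 \<le> l" "x \<in> A" "y \<in> A" "x \<noteq> y" "0 < dA x y"
  shows "dB (f x) (f y) \<le> l * dA x y"
proof -
  have "ennreal (dB (f x) (f y) / dA x y) \<le> lip_norm dA dB A f"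
    unfolding lip_norm_def by (rule SUP_upper2[of "(x, y)"]) (use assms in auto)
  then have "dB (f x) (f y) / dA x y \<le> l"
    using assms(1,2) by (simp add: ennreal_le_iff)
  then show ?thesis using assms(6) by (simp add: divide_le_eq)
qed

context connected_multigraph
begin

definition gball :: "'v \<Rightarrow> nat \<Rightarrow> 'v set" where
  "gball u r = {v \<in> verts G. path_dist G u v \<le> r}"

lemma gball_subset: "gball u r \<subseteq> verts G"
  by (auto simp: gball_def)

lemma finite_gball: "finite (gball u r)"
  using gball_subset finite_verts by (rule finite_subset)

lemma gball_zero:
  assumes "u \<in> verts G"
  shows "gball u 0 = {u}"
proof -
  have "v = u" if "v \<in> verts G" "path_dist G u v \<le> 0" for v
    using path_dist_pos[OF assms that(1)] that(2) by fastforce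
  moreover have "path_dist G u u \<le> 0"
    using assms by (simp only: path_dist_le_iff) (auto intro!: exI[of _ "[]"] simp: awalk_Nil_iff)
  ultimately show ?thesis using assms by (auto simp: gball_def)
qed

lemma head_in_gball_Suc:
  assumes "u \<in> verts G" "e \<in> arcs G" "tail G e \<in> gball u r"
  shows "head G e \<in> gball u (Suc r)"
proof -
  have "path_dist G u (head G e) \<le> path_dist G u (tail G e) + path_dist G (tail G e) (head G e)"
    using assms by (intro path_dist_triangle) auto
  then show ?thesis
    using path_dist_arc_le[OF assms(2)] assms by (auto simp: gball_def)
qed

lemma gball_SucE:
  assumes "u \<in> verts G" "w \<in> gball u (Suc r)"
  obtains "w \<in> gball u r" | e where "e \<in> arcs G" "tail G e \<in> gball u r" "head G e = w"
proof -
  have w: "w \<in> verts G" "path_dist G u w \<le> Suc r" using assms(2) by (auto simp: gball_def)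
  then obtain p where p: "awalk u p w" "length p \<le> Suc r"
    using path_dist_le_iff[OF assms(1)] by blast
  show ?thesis
  proof (cases p rule: rev_cases)
    case Nil
    then have "path_dist G u w \<le> r"
      unfolding path_dist_le_iff[OF assms(1) w(1)] using p by (intro exI[of _ "[]"]) auto
    then show ?thesis using w that(1) by (auto simp: gball_def)
  next
    case (snoc q e)
    then have e: "e \<in> arcs G" "head G e = w" "awalk u q (tail G e)"
      using p(1) by (auto simp: awalk_Cons_iff awalk_Nil_iff)
    then have "path_dist G u (tail G e) \<le> r"
      using p(2) snoc assms(1) by (subst path_dist_le_iff) (auto intro!: exI[of _ q])
    then show ?thesis using e that(2) by (auto simp: gball_def)
  qed
qed

lemma card_gball_le:
  assumes u: "u \<in> verts G" and deg: "\<And>v. v \<in> verts G \<Longrightarrow> out_degree G v \<le> D"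
  shows "card (gball u r) \<le> (1 + D) ^ r"
proof (induction r)
  case 0
  show ?case by (simp add: gball_zero[OF u])
next
  case (Suc r)
  have "gball u (Suc r) \<subseteq> gball u r \<union> (\<Union>v\<in>gball u r. head G ` out_arcs G v)"
  proof
    fix w assume "w \<in> gball u (Suc r)"
    with u show "w \<in> gball u r \<union> (\<Union>v\<in>gball u r. head G ` out_arcs G v)"
    proof (rule gball_SucE)
      fix e assume "e \<in> arcs G" "tail G e \<in> gball u r" "head G e = w"
      then have "w \<in> head G ` out_arcs G (tail G e)" by auto
      with \<open>tail G e \<in> gball u r\<close> show ?thesis by blast
    qed blast
  qed
  then have "card (gball u (Suc r)) \<le> card (gball u r \<union> (\<Union>v\<in>gball u r. head G ` out_arcs G v))"
    by (intro card_mono) (auto simp: finite_gball)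
  also have "\<dots> \<le> card (gball u r) + card (\<Union>v\<in>gball u r. head G ` out_arcs G v)"
    by (rule card_Un_le)
  also have "card (\<Union>v\<in>gball u r. head G ` out_arcs G v) \<le> (\<Sum>v\<in>gball u r. card (head G ` out_arcs G v))"
    by (rule card_UN_le[OF finite_gball])
  also have "\<dots> \<le> (\<Sum>v\<in>gball u r. D)"
  proof (rule sum_mono)
    fix v assume "v \<in> gball u r"
    then have "out_degree G v \<le> D" using deg gball_subset by blast
    moreover have "card (head G ` out_arcs G v) \<le> out_degree G v"
      unfolding out_degree_def by (intro card_image_le) auto
    ultimately show "card (head G ` out_arcs G v) \<le> D" by linarith
  qed
  also have "card (gball u r) + (\<Sum>v\<in>gball u r. D) = (1 + D) * card (gball u r)" by simp
  also have "\<dots> \<le> (1 + D) * (1 + D) ^ r" by (rule mult_left_mono[OF Suc]) simp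
  finally show ?case by simp
qed

text \<open>
  The Poincare inequality for the indicator function of \<open>B\<close>. Its mean is at most 1/2, so every vertex of
  \<open>B\<close> contributes at least 1/4 on the left. On the right, an oriented edge contributes only if it or its
  reversal leaves \<open>B\<close>, in which case one of its ends lies in \<open>N\<close>.
\<close>

lemma poincare_isoperimetric:
  assumes gap: "poincare TYPE(real) K G" and K: "0 < K"
    and deg: "\<And>v. v \<in> verts G \<Longrightarrow> out_degree G v \<le> D"
    and B: "B \<subseteq> verts G" "2 * card B \<le> card (verts G)"
    and N: "N \<subseteq> verts G" "\<And>e. e \<in> arcs G \<Longrightarrow> tail G e \<in> B \<Longrightarrow> head G e \<notin> B \<Longrightarrow> head G e \<in> N"
  shows "real (card B) \<le> 8 * K * real D * real (card N)"
proof -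
  define f where "f = (indicator B :: 'v \<Rightarrow> real)"
  define h where "h = (indicator N :: 'v \<Rightarrow> real)"
  define m where "m = vmean G f"
  have finB: "finite B" using B(1) finite_verts by (rule finite_subset)
  have "m = real (card B) / real (card (verts G))"
    using B(1) by (simp add: m_def vmean_def f_def indicator_def sum.If_cases Int_absorb1)
  then have m: "m \<le> 1 / 2"
    using B(2) card_verts_pos by (simp add: divide_le_eq)
  have "real (card B) * (1 / 2)\<^sup>2 \<le> (\<Sum>v\<in>B. (norm (f v - m))\<^sup>2)"
  proof -
    have "(1 / 2)\<^sup>2 \<le> (norm (f v - m))\<^sup>2" if "v \<in> B" for v
      using m that by (intro power_mono) (auto simp: f_def)
    then have "(\<Sum>v\<in>B. (1 / 2)\<^sup>2) \<le> (\<Sum>v\<in>B. (norm (f v - m))\<^sup>2)" by (rule sum_mono)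
    then show ?thesis by simp
  qed
  also have "\<dots> \<le> (\<Sum>v\<in>verts G. (norm (f v - m))\<^sup>2)"
    using B(1) by (intro sum_mono2) auto
  also have "\<dots> \<le> K * dirichlet G f"
    using gap unfolding poincare_def m_def by (rule spec)
  also have "\<dots> \<le> K * (2 * (real D * real (card N)))"
  proof (intro mult_left_mono)
    obtain rev where rev: "\<forall>e\<in>arcs G. rev e \<in> arcs G \<and> rev (rev e) = e \<and>
            tail G (rev e) = head G e \<and> head G (rev e) = tail G e"
      using reversal by blast
    have N': "tail G e \<in> N" if "e \<in> arcs G" "head G e \<in> B" "tail G e \<notin> B" for e
      using N(2)[of "rev e"] rev that by auto
    have "dirichlet G f \<le> (\<Sum>v\<in>verts G. \<Sum>e\<in>out_arcs G v. h v + h (head G e))"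
      unfolding dirichlet_def
    proof (intro sum_mono)
      fix v e assume e: "e \<in> out_arcs G v"
      show "(norm (f (head G e) - f v))\<^sup>2 \<le> h v + h (head G e)"
        using e N(2)[of e] N'[of e] by (auto simp: f_def h_def indicator_def)
    qed
    also have "\<dots> = (\<Sum>v\<in>verts G. \<Sum>e\<in>out_arcs G v. h v) + (\<Sum>v\<in>verts G. \<Sum>e\<in>out_arcs G v. h (head G e))"
      by (simp only: sum.distrib)
    also have "\<dots> \<le> real D * (\<Sum>v\<in>verts G. h v) + real D * (\<Sum>v\<in>verts G. h v)"
      using deg by (intro add_mono sum_out_arcs_tail_le sum_out_arcs_head_le) (auto simp: h_def)
    also have "(\<Sum>v\<in>verts G. h v) = real (card N)"
      using N(1) by (simp add: h_def indicator_def sum.If_cases Int_absorb1)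
    finally show "dirichlet G f \<le> 2 * (real D * real (card N))" by simp
  qed (use K in simp)
  finally show ?thesis by (simp add: power2_eq_square)
qed

text \<open>
  As long as a ball contains at most half of the vertices, its outer boundary is at least a fixed
  proportion of it, so balls grow exponentially.
\<close>

lemma gball_growth:
  assumes gap: "poincare TYPE(real) K G" and K: "0 < K"
    and deg: "\<And>v. v \<in> verts G \<Longrightarrow> out_degree G v \<le> D" and D: "1 \<le> D" and u: "u \<in> verts G"
  shows "card (verts G) < 2 * card (gball u r) \<or> (1 + 1 / (8 * K * real D)) ^ r \<le> real (card (gball u r))"
proof (induction r)
  case 0
  show ?case by (simp add: gball_zero[OF u])
next
  case (Suc r)
  have mono: "gball u r \<subseteq> gball u (Suc r)" by (auto simp: gball_def)
  show ?case
  proof (cases "card (verts G) < 2 * card (gball u r)")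
    case True
    then show ?thesis using card_mono[OF finite_gball mono] by linarith
  next
    case False
    let ?a = "1 / (8 * K * real D)"
    have IH: "(1 + ?a) ^ r \<le> real (card (gball u r))" using Suc False by blast
    have "real (card (gball u r)) \<le> 8 * K * real D * real (card (gball u (Suc r) - gball u r))"
      by (rule poincare_isoperimetric[OF gap K deg])
        (use False gball_subset head_in_gball_Suc[OF u] in auto)
    also have "real (card (gball u (Suc r) - gball u r)) = real (card (gball u (Suc r))) - real (card (gball u r))"
      using card_mono[OF finite_gball mono] by (simp add: card_Diff_subset[OF finite_gball mono] of_nat_diff)
    finally have "(1 + ?a) * real (card (gball u r)) \<le> real (card (gball u (Suc r)))"
      using K D by (simp add: field_simps)
    moreover have "(1 + ?a) * (1 + ?a) ^ r \<le> (1 + ?a) * real (card (gball u r))"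
      using IH K by (intro mult_left_mono) auto
    ultimately show ?thesis by simp
  qed
qed

text \<open>
  Two balls with more than half of the vertices each must meet.
\<close>

lemma diam_le_if_gballs_large:
  assumes "\<And>u. u \<in> verts G \<Longrightarrow> card (verts G) < 2 * card (gball u r)"
  shows "diam G \<le> 2 * r"
proof (rule diam_le)
  fix u v assume uv: "u \<in> verts G" "v \<in> verts G"
  have "gball u r \<inter> gball v r \<noteq> {}"
  proof
    assume "gball u r \<inter> gball v r = {}"
    then have "card (gball u r) + card (gball v r) = card (gball u r \<union> gball v r)"
      by (simp add: card_Un_disjoint finite_gball)
    also have "\<dots> \<le> card (verts G)"
      by (intro card_mono) (use gball_subset in auto)
    finally show False using assms[OF uv(1)] assms[OF uv(2)] by linarith
  qed
  then obtain w where w: "w \<in> verts G" "path_dist G u w \<le> r" "path_dist G v w \<le> r"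
    by (auto simp: gball_def)
  have "path_dist G u v \<le> path_dist G u w + path_dist G w v"
    by (rule path_dist_triangle[OF uv(1) w(1) uv(2)])
  then show "path_dist G u v \<le> 2 * r"
    using w(2,3) path_dist_sym[OF uv(2) w(1)] by linarith
qed

text \<open>
  A ball of radius \<open>d\<close> has at most \<open>(1 + D) ^ d\<close> vertices; if it has at least half of them all, then the
  exponential growth of balls makes each ball of radius \<open>q * d + 1\<close> contain more than half. Here \<open>q\<close>
  compares the two rates of growth, and the additional step makes the inequality strict.
\<close>

lemma poincare_diam_le:
  assumes gap: "poincare TYPE(real) K G" and K: "0 < K"
    and deg: "\<And>v. v \<in> verts G \<Longrightarrow> out_degree G v \<le> D" and D: "1 \<le> D"
    and q: "1 + real D \<le> (1 + 1 / (8 * K * real D)) ^ q"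
    and v: "v \<in> verts G" "card (verts G) \<le> 2 * card (gball v d)"
  shows "diam G \<le> 2 * (q * d + 1)"
proof (rule diam_le_if_gballs_large)
  fix u assume u: "u \<in> verts G"
  let ?b = "1 + 1 / (8 * K * real D)"
  have "real (card (verts G)) \<le> real (2 * (1 + D) ^ d)"
    using v(2) card_gball_le[OF v(1) deg, of d] by (intro of_nat_mono) linarith
  also have "\<dots> = 2 * (1 + real D) ^ d" by simp
  also have "\<dots> \<le> 2 * (?b ^ q) ^ d"
    using q by (intro mult_left_mono power_mono) auto
  also have "\<dots> = 2 * ?b ^ (q * d)" by (simp add: power_mult)
  also have "\<dots> < 2 * ?b ^ (q * d + 1)"
    using K D by (intro mult_strict_left_mono power_strict_increasing) auto
  finally show "card (verts G) < 2 * card (gball u (q * d + 1))"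
    using gball_growth[OF gap K deg D u, of "q * d + 1"] by auto
qed

text \<open>
  Let \<open>l\<close> and \<open>m\<close> be the Lipschitz constants of \<open>f\<close> and its inverse. The Dirichlet form of \<open>f\<close> is at most
  \<open>D * l\<^sup>2\<close> per vertex, so by the Poincare inequality the mean square deviation of \<open>f\<close> from its mean is at
  most \<open>K' * D * l\<^sup>2\<close>, and by Markov's inequality at least half of the vertices are mapped into a ball of
  radius \<open>\<rho> = sqrt (2 * K' * D) * l\<close>. These vertices have mutual distances at most \<open>2 * \<rho> * m\<close>, a multiple
  of \<open>l * m\<close>, and by \<open>poincare_diam_le\<close> so few steps suffice for half of the graph only if the diameter is
  also at most a multiple of \<open>l * m\<close>.
\<close>

lemma poincare_bi_lipschitz_diam_le:
  fixes f :: "'v \<Rightarrow> 'x::banach"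
  assumes gap: "poincare TYPE(real) K G" and K: "0 < K"
    and gapX: "poincare TYPE('x) K' G" and K': "0 < K'"
    and deg: "\<And>v. v \<in> verts G \<Longrightarrow> out_degree G v \<le> D" and D: "1 \<le> D"
    and q: "1 + real D \<le> (1 + 1 / (8 * K * real D)) ^ q"
    and f: "bi_lipschitz G f"
  shows "ennreal (real (diam G)) \<le> ennreal (2 * real q * (2 * sqrt (2 * K' * real D)) + 2) * (lip_graph G f * lip_graph_inv G f)"
proof -
  define n where "n = card (verts G)"
  obtain l where l: "lip_graph G f = ennreal l" "0 \<le> l"
    using f unfolding bi_lipschitz_def by (cases "lip_graph G f") auto
  obtain m where m: "lip_graph_inv G f = ennreal m" "0 \<le> m"
    using f unfolding bi_lipschitz_def by (cases "lip_graph_inv G f") auto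
  have inj: "inj_on f (verts G)" using f by (simp add: bi_lipschitz_def)
  have up: "dist (f u) (f v) \<le> l * real (path_dist G u v)" if uv: "u \<in> verts G" "v \<in> verts G" for u v
  proof (cases "u = v")
    case False
    show ?thesis
      using lip_normD[OF l(1)[unfolded lip_graph_def] l(2) uv False] path_dist_pos[OF uv False] by simp
  qed (use l in simp)
  have low: "real (path_dist G u v) \<le> m * dist (f u) (f v)" if uv: "u \<in> verts G" "v \<in> verts G" "u \<noteq> v" for u v
  proof -
    have ne: "f u \<noteq> f v" using inj uv by (auto simp: inj_on_def)
    show ?thesis
      using lip_normD[OF m(1)[unfolded lip_graph_inv_def] m(2) imageI[OF uv(1)] imageI[OF uv(2)] ne] ne
      by (simp add: inv_into_f_f[OF inj] uv)
  qed
  \<comment> \<open>This absorbs the additive constant in the bound on the diameter.\<close>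
  have lm: "1 \<le> l * m"
  proof -
    obtain u v where uv: "u \<in> verts G" "v \<in> verts G" "u \<noteq> v"
      using two_verts card_le_Suc0_iff_eq[OF finite_verts]
      by (metis numeral_2_eq_2 not_less_eq_eq)
    have "real (path_dist G u v) \<le> m * (l * real (path_dist G u v))"
      using low[OF uv] mult_left_mono[OF up[OF uv(1,2)] m(2)] by linarith
    then have "real (path_dist G u v) * 1 \<le> real (path_dist G u v) * (l * m)" by (simp add: mult_ac)
    then show ?thesis using path_dist_pos[OF uv] by (simp only: mult_le_cancel_left_pos of_nat_0_less_iff)
  qed
  then have lpos: "0 < l" using l(2) by (cases "l = 0") auto
  define \<rho> where "\<rho> = sqrt (2 * K' * real D) * l"
  have \<rho>0: "0 \<le> \<rho>" using lpos K' by (simp add: \<rho>_def)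
  have \<rho>2: "\<rho>\<^sup>2 = 2 * K' * real D * l\<^sup>2" using K' by (simp add: \<rho>_def power_mult_distrib)
  have \<rho>pos: "0 < \<rho>\<^sup>2" unfolding \<rho>2 using K' D lpos by simp
  define S where "S = {v \<in> verts G. norm (f v - vmean G f) \<le> \<rho>}"
  define T where "T = verts G - S"
  have "dirichlet G f \<le> (\<Sum>v\<in>verts G. \<Sum>e\<in>out_arcs G v. l\<^sup>2)"
    unfolding dirichlet_def
  proof (intro sum_mono power_mono)
    fix v e assume "v \<in> verts G" and e: "e \<in> out_arcs G v"
    have "norm (f (head G e) - f v) = dist (f (tail G e)) (f (head G e))"
      using e by (simp add: dist_norm norm_minus_commute)
    also have "\<dots> \<le> l * real (path_dist G (tail G e) (head G e))"
      using e by (intro up) auto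
    also have "\<dots> \<le> l * 1"
      using e path_dist_arc_le[of e] l(2) by (intro mult_left_mono) auto
    finally show "norm (f (head G e) - f v) \<le> l" by simp
  qed simp
  also have "\<dots> \<le> real D * (\<Sum>v\<in>verts G. l\<^sup>2)"
    using sum_out_arcs_tail_le[OF deg, of "\<lambda>_. l\<^sup>2"] by simp
  finally have dir: "dirichlet G f \<le> real D * (real n * l\<^sup>2)" by (simp add: n_def)
  have "real (card T) * \<rho>\<^sup>2 = (\<Sum>v\<in>T. \<rho>\<^sup>2)" by simp
  also have "\<dots> \<le> (\<Sum>v\<in>T. (norm (f v - vmean G f))\<^sup>2)"
    using \<rho>0 by (intro sum_mono power_mono) (auto simp: T_def S_def)
  also have "\<dots> \<le> (\<Sum>v\<in>verts G. (norm (f v - vmean G f))\<^sup>2)"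
    by (intro sum_mono2) (auto simp: T_def)
  also have "\<dots> \<le> K' * dirichlet G f"
    using gapX unfolding poincare_def by (rule spec)
  also have "\<dots> \<le> K' * (real D * (real n * l\<^sup>2))"
    using dir K' by (intro mult_left_mono) auto
  also have "\<dots> = (real n / 2) * \<rho>\<^sup>2" by (simp add: \<rho>2)
  finally have "real (card T) \<le> real n / 2" using \<rho>pos by (simp only: mult_le_cancel_right_pos)
  then have "2 * card T \<le> n" by linarith
  moreover have "card T = n - card S"
    unfolding T_def n_def by (rule card_Diff_subset) (auto simp: S_def)
  ultimately have S: "n \<le> 2 * card S" by linarith
  then have "S \<noteq> {}" using card_verts_pos by (auto simp: n_def)
  then obtain v where v: "v \<in> S" by blast
  then have vV: "v \<in> verts G" by (simp add: S_def)
  define d where "d = nat \<lfloor>2 * \<rho> * m\<rfloor>"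
  have "S \<subseteq> gball v d"
  proof
    fix w assume w: "w \<in> S"
    then have wV: "w \<in> verts G" by (simp add: S_def)
    have "path_dist G v w \<le> d"
    proof (cases "v = w")
      case True
      then show ?thesis using gball_zero[OF vV] by (auto simp: gball_def)
    next
      case False
      have "dist (f v) (f w) \<le> norm (f v - vmean G f) + norm (f w - vmean G f)"
        using dist_triangle2[of "f v" "f w" "vmean G f"] by (simp add: dist_norm)
      also have "\<dots> \<le> 2 * \<rho>" using v w by (auto simp: S_def)
      finally have "m * dist (f v) (f w) \<le> m * (2 * \<rho>)" using m(2) by (rule mult_left_mono)
      then have "real (path_dist G v w) \<le> 2 * \<rho> * m"
        using low[OF vV wV False] by (simp add: mult_ac)
      then show ?thesis unfolding d_def by (simp add: le_nat_floor)
    qed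
    then show "w \<in> gball v d" using wV by (simp add: gball_def)
  qed
  then have "card S \<le> card (gball v d)" by (rule card_mono[OF finite_gball])
  then have "diam G \<le> 2 * (q * d + 1)"
    using S by (intro poincare_diam_le[OF gap K deg D q vV]) (auto simp: n_def)
  then have "real (diam G) \<le> real (2 * (q * d + 1))" by (rule of_nat_mono)
  also have "\<dots> = 2 * real q * real d + 2" by simp
  also have "\<dots> \<le> 2 * real q * (2 * \<rho> * m) + 2 * (l * m)"
  proof -
    have "real d \<le> 2 * \<rho> * m" unfolding d_def using \<rho>0 m(2) by (simp add: of_nat_nat)
    then have "2 * real q * real d \<le> 2 * real q * (2 * \<rho> * m)" by (intro mult_left_mono) auto
    then show ?thesis using lm by linarith
  qed
  also have "\<dots> = (2 * real q * (2 * sqrt (2 * K' * real D)) + 2) * (l * m)"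
    by (simp add: \<rho>_def algebra_simps)
  finally have "ennreal (real (diam G)) \<le> ennreal ((2 * real q * (2 * sqrt (2 * K' * real D)) + 2) * (l * m))"
    by (rule ennreal_leI)
  also have "\<dots> = ennreal (2 * real q * (2 * sqrt (2 * K' * real D)) + 2) * (ennreal l * ennreal m)"
    using l(2) m(2) K' by (subst ennreal_mult, simp, simp, subst ennreal_mult) auto
  finally show ?thesis by (simp only: l(1) m(1))
qed

end


theorem corollary6p1:
  fixes G :: "nat \<Rightarrow> ('v, 'e) pre_digraph"
  assumes "\<And>n. connected_multigraph (G n)"
    and "expanders G"
    and "infinite_dimensional TYPE('x::banach)"
    and "uniformly_curved TYPE('y::banach)"
    and "sphere_equivalent TYPE('x) TYPE('y)"
  shows "\<exists>c C :: real. 0 < c \<and> c \<le> C \<and>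
    (\<forall>n. ennreal (c * real (diam (G n))) \<le> distortion TYPE('x) (G n) \<and>
         distortion TYPE('x) (G n) \<le> ennreal (C * real (diam (G n))))"
proof -
  obtain K where K: "0 < K" "\<And>n. poincare TYPE(real) K (G n)"
    using expanders_poincare[OF assms(1,2)] by metis
  obtain D0 where D0: "\<And>n. max_degree (G n) \<le> D0"
    using assms(2) unfolding anders_def bdd_above_def by blast
  define D where "D = max 1 D0"
  have D: "1 \<le> D" by (simp add: D_def)
  have deg: "out_degree (G n) v \<le> D" if "v \<in> verts (G n)" for n v
    using connected_multigraph.out_degree_le_max_degree[OF assms(1) that] D0[of n]
    unfolding D_def by linarith
  obtain KY where KY: "0 < KY" "\<And>H :: ('v, 'e) pre_digraph. connected_multigraph H \<Longrightarrow>
       (\<And>v. v \<in> verts H \<Longrightarrow> out_degree H v \<le> D) \<Longrightarrow> poincare TYPE(real) K H \<Longrightarrow> poincare TYPE('y) KY H"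
    using uniformly_curved_poincare[OF assms(4) K(1) D, where 'v = 'v and 'e = 'e] by metis
  obtain KX where KX: "0 < KX" "\<And>H :: ('v, 'e) pre_digraph. connected_multigraph H \<Longrightarrow>
       (\<And>v. v \<in> verts H \<Longrightarrow> out_degree H v \<le> D) \<Longrightarrow> poincare TYPE('y) KY H \<Longrightarrow> poincare TYPE('x) KX H"
    using sphere_equivalent_poincare[OF assms(5) KY(1), of D, where 'v = 'v and 'e = 'e] by metis
  have gapX: "poincare TYPE('x) KX (G n)" for n
    by (rule KX(2)[OF assms(1) deg KY(2)[OF assms(1) deg K(2)]])
  obtain q where q: "1 + real D < (1 + 1 / (8 * K * real D)) ^ q"
    using real_arch_pow[of "1 + 1 / (8 * K * real D)" "1 + real D"] K(1) D by auto
  \<comment> \<open>The bound on the diameter in terms of the distortion; its reciprocal is the lower constant.\<close>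
  define b where "b = 2 * real q * (2 * sqrt (2 * KX * real D)) + 2"
  have b: "2 \<le> b" using KX(1) by (simp add: b_def)
  have "ennreal (1 / b * real (diam (G n))) \<le> distortion TYPE('x) (G n)" for n
    unfolding distortion_def
  proof (rule INF_greatest)
    fix f :: "'v \<Rightarrow> 'x" assume "f \<in> {f. bi_lipschitz (G n) f}"
    then have "ennreal (real (diam (G n))) \<le> ennreal b * (lip_graph (G n) f * lip_graph_inv (G n) f)"
      unfolding b_def
      by (intro connected_multigraph.poincare_bi_lipschitz_diam_le[OF assms(1) K(2) K(1) gapX KX(1) deg D])
        (use q in auto)
    then have "ennreal (1 / b) * ennreal (real (diam (G n)))
        \<le> ennreal (1 / b) * (ennreal b * (lip_graph (G n) f * lip_graph_inv (G n) f))"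
      by (rule mult_left_mono) simp
    also have "\<dots> = ennreal (1 / b * b) * (lip_graph (G n) f * lip_graph_inv (G n) f)"
      using b by (subst ennreal_mult) (auto simp: mult.assoc)
    also have "\<dots> = lip_graph (G n) f * lip_graph_inv (G n) f" using b by simp
    finally show "ennreal (1 / b * real (diam (G n))) \<le> lip_graph (G n) f * lip_graph_inv (G n) f"
      using b by (subst ennreal_mult) auto
  qed
  moreover have "distortion TYPE('x) (G n) \<le> ennreal (4 * real (diam (G n)))" for n
    by (rule connected_multigraph.distortion_le_diam[OF assms(1,3)])
  moreover have "0 < 1 / b" "1 / b \<le> 4" using b by (simp_all add: divide_le_eq)
  ultimately show ?thesis by blast
qed

end
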